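(* Let $\Bbbk$ be a field of characteristic $0$ and let $\mathcal H$ be a (not necessarily commutative) Hopf algebroid over a commutative $\Bbbk$-algebra $A$ such that $s_l=t_r=t$ and $s_r=t_l=s$. Then the set $\mathfrak{Brt}(\mathcal H,A)$ of local biretractions of $\mathcal H$, with the convolution product $$(\alpha\ast\beta)(h)=\beta\big(t(\alpha(h_{(1)}))\,h_{(2)}\big)=\beta(t(\alpha(h_{(1)})))\,\beta(h_{(2)}),\qquad h\in\mathcal H,$$ is a regular semigroup.
   Context: Left bialgebroid over $A$: a quintuple $(\mathcal H,s_l,t_l,\Delta_l,\varepsilon_l)$ where $\mathcal H$ is a unital $\Bbbk$-algebra and: (LB1) $s_l:A\to\mathcal H$ is an algebra morphism and $t_l:A\to\mathcal H$ an algebra antimorphism with $s_l(a)t_l(b)=t_l(b)s_l(a)$, making $\mathcal H$ an $A$-bimodule by $a\triangleright h\triangleleft b=s_l(a)t_l(b)h$; (LB2) $(\mathcal H,\Delta_l,\varepsilon_l)$ is an $A$-coring for this bimodule structure; (LB3) $\Delta_l(\mathcal H)\subseteq\{\sum h_i\otimes k_i\in\mathcal H\otimes_A\mathcal H:\sum h_it_l(a)\otimes k_i=\sum h_i\otimes k_is_l(a)\ \forall a\in A\}$ and the corestriction of $\Delta_l$ to this set is an algebra morphism; (LB4) $\varepsilon_l(hk)=\varepsilon_l(h\,s_l(\varepsilon_l(k)))=\varepsilon_l(h\,t_l(\varepsilon_l(k)))$. Right bialgebroid over $A$: a quintuple $(\mathcal H,s_r,t_r,\Delta_r,\varepsilon_r)$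 where $\mathcal H$ is a unital $\Bbbk$-algebra and: (RB1) $s_r$ is an algebra morphism and $t_r$ an algebra antimorphism $A\to\mathcal H$ with commuting images, making $\mathcal H$ an $A$-bimodule by $a\blacktriangleright h\blacktriangleleft b=h\,t_r(a)s_r(b)$; (RB2) $(\mathcal H,\Delta_r,\varepsilon_r)$ is an $A$-coring for this bimodule structure; (RB3) $\Delta_r(\mathcal H)\subseteq\{\sum h_i\otimes k_i\in\mathcal H\otimes_A\mathcal H:\sum s_r(a)h_i\otimes k_i=\sum h_i\otimes t_r(a)k_i\ \forall a\in A\}$ and the corestriction of $\Delta_r$ to this set is an algebra morphism; (RB4) $\varepsilon_r(hk)=\varepsilon_r(s_r(\varepsilon_r(h))k)=\varepsilon_r(t_r(\varepsilon_r(h))k)$. Hopf algebroid over $A$ (both base algebras equal to the commutative algebra $A$): an algebra $\mathcal H$ with a left bialgebroid structure and a right bialgebroid structure over $A$ and a $\Bbbk$-linear map $S:\mathcal H\to\mathcal H$ such that: (HA2) $s_l\varepsilon_lt_r=t_r$, $t_l\varepsilon_ls_r=s_r$, $s_r\varepsilon_rt_l=t_l$, $t_r\varepsilon_rs_l=s_l$; (HA3) $(\Delta_l\otimes_A\mathcal H)\Delta_r=(\mathcal H\otimes_A\Delta_r)\Delta_l$ and $(\Delta_r\otimes_A\mathcal H)\Delta_l=(\mathcal H\otimes_A\Delta_l)\Delta_r$ (each tensor product over $A$ being formed with the left or right bimodule structure as dictated by the corresponding comultiplication); (HA4) $S(t_l(a)\,h\,t_r(b))=s_r(b)S(h)s_l(a)$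 for all $a,b\in A$, $h\in\mathcal H$; (HA5) writing $\Delta_l(h)=h_{(1)}\otimes h_{(2)}$ and $\Delta_r(h)=h^{(1)}\otimes h^{(2)}$, $S(h_{(1)})h_{(2)}=s_r(\varepsilon_r(h))$ and $h^{(1)}S(h^{(2)})=s_l(\varepsilon_l(h))$. Local biretraction of $\mathcal H$ (when $s_l=t_r=t$ and $s_r=t_l=s$): a $\Bbbk$-linear and multiplicative (not necessarily unital) map $\alpha:\mathcal H\to A$ such that (BRT1) $\alpha(s(a))=a\,\alpha(1_{\mathcal H})$ for every $a\in A$; (BRT2) there exists $e^\alpha\in A$ such that $\alpha(t(e^\alpha))=\alpha(1_{\mathcal H})$ and $\alpha\circ t|_{Ae^\alpha}:Ae^\alpha\to A\,\alpha(1_{\mathcal H})$ is a bijection. A semigroup is regular if each element $x$ has a pseudo-inverse, i.e. an element $x^*$ with $xx^*x=x$ and $x^*xx^*=x^*$. *)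

theory Defs
  imports Complex_Main "HOL-Library.Multiset"
begin

section \<open>Algebras over a field\<close>

text \<open>
  Algebras are unital and associative.  The unit is an explicit parameter and the type class is
  \<^class>\<open>ring\<close> rather than \<^class>\<open>ring_1\<close>, because the latter imposes \<open>0 \<noteq> 1\<close> and would exclude the
  zero algebra.
\<close>

locale unital_algebra = vector_space scale
  for scale :: "'k::field \<Rightarrow> 'h::ring \<Rightarrow> 'h" +
  fixes one :: 'h
  assumes one_left: "one * x = x"
    and one_right: "x * one = x"
    and scale_mult_left: "scale c (x * y) = scale c x * y"
    and scale_mult_right: "scale c (x * y) = x * scale c y"

locale algebra_morphism =
  A: unital_algebra scaleA oneA + B: unital_algebra scaleB oneB + Vector_Spaces.linear scaleA scaleB f
  for scaleA :: "'k::field \<Rightarrow> 'a::ring \<Rightarrow> 'a" and oneA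
    and scaleB :: "'k \<Rightarrow> 'b::ring \<Rightarrow> 'b" and oneB and f +
  assumes map_one: "f oneA = oneB"
    and map_mult: "f (x * y) = f x * f y"

locale algebra_antimorphism =
  A: unital_algebra scaleA oneA + B: unital_algebra scaleB oneB + Vector_Spaces.linear scaleA scaleB f
  for scaleA :: "'k::field \<Rightarrow> 'a::ring \<Rightarrow> 'a" and oneA
    and scaleB :: "'k \<Rightarrow> 'b::ring \<Rightarrow> 'b" and oneB and f +
  assumes map_one: "f oneA = oneB"
    and map_mult: "f (x * y) = f y * f x"

text \<open>Unital bimodules over the \<open>k\<close>-algebra \<open>A\<close>, with \<open>k\<close> acting centrally;
  \<open>lact a m\<close> is the left action and \<open>ract m a\<close> the right action.\<close>

locale bimodule =
  A: unital_algebra scaleA oneA + M: vector_space scaleM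
  for scaleA :: "'k::field \<Rightarrow> 'a::ring \<Rightarrow> 'a" and oneA
    and scaleM :: "'k \<Rightarrow> 'm::ab_group_add \<Rightarrow> 'm" +
  fixes lact :: "'a \<Rightarrow> 'm \<Rightarrow> 'm" and ract :: "'m \<Rightarrow> 'a \<Rightarrow> 'm"
  assumes lact_linear: "Vector_Spaces.linear scaleM scaleM (lact a)"
    and lact_linear_scalar: "Vector_Spaces.linear scaleA scaleM (\<lambda>a. lact a m)"
    and ract_linear: "Vector_Spaces.linear scaleM scaleM (\<lambda>m. ract m a)"
    and ract_linear_scalar: "Vector_Spaces.linear scaleA scaleM (ract m)"
    and lact_one: "lact oneA m = m"
    and ract_one: "ract m oneA = m"
    and lact_mult: "lact (a * b) m = lact a (lact b m)"
    and ract_mult: "ract m (a * b) = ract (ract m a) b"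
    and lact_ract: "lact a (ract m b) = ract (lact a m) b"

section \<open>Tensor products\<close>

text \<open>
  A multiset \<open>{#(x\<^sub>1,y\<^sub>1), \<dots>, (x\<^sub>n,y\<^sub>n)#}\<close> stands for the formal sum \<open>\<Sum> x\<^sub>i \<otimes> y\<^sub>i\<close>.  The tensor product
  is the quotient of the free commutative monoid of formal sums by the congruence generated by
  biadditivity and by the balancing relation \<open>xa \<otimes> y = x \<otimes> ay\<close>.  This quotient is the usual
  balanced tensor product of abelian groups: \<open>(-x) \<otimes> y\<close> is inverse to \<open>x \<otimes> y\<close>, so passing to formal
  differences first would add nothing.  For modules over a \<open>k\<close>-algebra \<open>A\<close> it is also the
  \<open>k\<close>-module \<open>M \<otimes>\<^sub>A N\<close>, since \<open>k\<close> acts through \<open>A\<close>.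
\<close>

inductive additive_congruence ::
  "('x multiset \<Rightarrow> 'x multiset \<Rightarrow> bool) \<Rightarrow> 'x multiset \<Rightarrow> 'x multiset \<Rightarrow> bool"
  for G where
  gen: "G c d \<Longrightarrow> additive_congruence G c d"
| refl: "additive_congruence G c c"
| sym: "additive_congruence G c d \<Longrightarrow> additive_congruence G d c"
| trans: "additive_congruence G c d \<Longrightarrow> additive_congruence G d e \<Longrightarrow> additive_congruence G c e"
| add: "additive_congruence G c d \<Longrightarrow> additive_congruence G c' d' \<Longrightarrow>
        additive_congruence G (c + c') (d + d')"

inductive tensor2_gen ::
  "('m::ab_group_add \<Rightarrow> 'a \<Rightarrow> 'm) \<Rightarrow> ('a \<Rightarrow> 'n::ab_group_add \<Rightarrow> 'n) \<Rightarrow>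
   ('m \<times> 'n) multiset \<Rightarrow> ('m \<times> 'n) multiset \<Rightarrow> bool"
  for ract lact where
  add1: "tensor2_gen ract lact {#(x + x', y)#} {#(x, y), (x', y)#}"
| add2: "tensor2_gen ract lact {#(x, y + y')#} {#(x, y), (x, y')#}"
| zero1: "tensor2_gen ract lact {#(0, y)#} {#}"
| zero2: "tensor2_gen ract lact {#(x, 0)#} {#}"
| balanced: "tensor2_gen ract lact {#(ract x a, y)#} {#(x, lact a y)#}"

text \<open>The threefold product \<open>M \<otimes>\<^sub>A N \<otimes>\<^sub>A P\<close>, where the two tensor signs may refer to different pairs
  of module structures: the first one uses \<open>ract\<close>, \<open>lact\<close> and the second one \<open>ract'\<close>, \<open>lact'\<close>.\<close>

inductive tensor3_gen ::
  "('m::ab_group_add \<Rightarrow> 'a \<Rightarrow> 'm) \<Rightarrow> ('a \<Rightarrow> 'n::ab_group_add \<Rightarrow> 'n) \<Rightarrow>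
   ('n \<Rightarrow> 'b \<Rightarrow> 'n) \<Rightarrow> ('b \<Rightarrow> 'p::ab_group_add \<Rightarrow> 'p) \<Rightarrow>
   ('m \<times> 'n \<times> 'p) multiset \<Rightarrow> ('m \<times> 'n \<times> 'p) multiset \<Rightarrow> bool"
  for ract lact ract' lact' where
  add1: "tensor3_gen ract lact ract' lact' {#(x + x', y, z)#} {#(x, y, z), (x', y, z)#}"
| add2: "tensor3_gen ract lact ract' lact' {#(x, y + y', z)#} {#(x, y, z), (x, y', z)#}"
| add3: "tensor3_gen ract lact ract' lact' {#(x, y, z + z')#} {#(x, y, z), (x, y, z')#}"
| zero1: "tensor3_gen ract lact ract' lact' {#(0, y, z)#} {#}"
| zero2: "tensor3_gen ract lact ract' lact' {#(x, 0, z)#} {#}"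
| zero3: "tensor3_gen ract lact ract' lact' {#(x, y, 0)#} {#}"
| balanced1: "tensor3_gen ract lact ract' lact' {#(ract x a, y, z)#} {#(x, lact a y, z)#}"
| balanced2: "tensor3_gen ract lact ract' lact' {#(x, ract' y b, z)#} {#(x, y, lact' b z)#}"

definition tensor2_rel ::
  "('m::ab_group_add \<Rightarrow> 'a \<Rightarrow> 'm) \<Rightarrow> ('a \<Rightarrow> 'n::ab_group_add \<Rightarrow> 'n) \<Rightarrow> ('m \<times> 'n) multiset rel" where
  "tensor2_rel ract lact = {(c, d). additive_congruence (tensor2_gen ract lact) c d}"

definition tensor3_rel ::
  "('m::ab_group_add \<Rightarrow> 'a \<Rightarrow> 'm) \<Rightarrow> ('a \<Rightarrow> 'n::ab_group_add \<Rightarrow> 'n) \<Rightarrow>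
   ('n \<Rightarrow> 'b \<Rightarrow> 'n) \<Rightarrow> ('b \<Rightarrow> 'p::ab_group_add \<Rightarrow> 'p) \<Rightarrow> ('m \<times> 'n \<times> 'p) multiset rel" where
  "tensor3_rel ract lact ract' lact' =
     {(c, d). additive_congruence (tensor3_gen ract lact ract' lact') c d}"

definition tensor2 ::
  "('m::ab_group_add \<Rightarrow> 'a \<Rightarrow> 'm) \<Rightarrow> ('a \<Rightarrow> 'n::ab_group_add \<Rightarrow> 'n) \<Rightarrow> ('m \<times> 'n) multiset set set" where
  "tensor2 ract lact = UNIV // tensor2_rel ract lact"

text \<open>
  \<open>sweedler \<Delta> h\<close> is a formal sum \<open>\<Sum> h\<^sub>(\<^sub>1\<^sub>) \<otimes> h\<^sub>(\<^sub>2\<^sub>)\<close> representing \<open>\<Delta> h\<close>.  It is only fed into expressions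
  that are balanced in the appropriate sense (given the remaining axioms), so the chosen
  representative is immaterial.
\<close>

definition sweedler :: "('h \<Rightarrow> 'x multiset set) \<Rightarrow> 'h \<Rightarrow> 'x multiset" where
  "sweedler \<Delta> h = (SOME c. c \<in> \<Delta> h)"

text \<open>\<open>\<Delta> \<otimes> id\<close> and \<open>id \<otimes> \<Delta>\<close> on formal sums.\<close>

definition comult_fst ::
  "('h \<Rightarrow> ('u \<times> 'v) multiset set) \<Rightarrow> ('h \<times> 'n) multiset \<Rightarrow> ('u \<times> 'v \<times> 'n) multiset" where
  "comult_fst \<Delta> c = (\<Sum>(x, y)\<in>#c. image_mset (\<lambda>(u, v). (u, v, y)) (sweedler \<Delta> x))"

definition comult_snd ::
  "('h \<Rightarrow> ('u \<times> 'v) multiset set) \<Rightarrow> ('m \<times> 'h) multiset \<Rightarrow> ('m \<times> 'u \<times> 'v) multiset" where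
  "comult_snd \<Delta> c = (\<Sum>(x, y)\<in>#c. image_mset (\<lambda>(u, v). (x, u, v)) (sweedler \<Delta> y))"

definition tensor_mult :: "('h::ring \<times> 'h) multiset \<Rightarrow> ('h \<times> 'h) multiset \<Rightarrow> ('h \<times> 'h) multiset" where
  "tensor_mult c d = (\<Sum>(x, y)\<in>#c. image_mset (\<lambda>(u, v). (x * u, y * v)) d)"

section \<open>Corings and bialgebroids\<close>

locale coring = bimodule scaleA oneA scaleC lact ract
  for scaleA :: "'k::field \<Rightarrow> 'a::ring \<Rightarrow> 'a" and oneA
    and scaleC :: "'k \<Rightarrow> 'c::ab_group_add \<Rightarrow> 'c" and lact ract +
  fixes \<Delta> :: "'c \<Rightarrow> ('c \<times> 'c) multiset set" and \<epsilon> :: "'c \<Rightarrow> 'a"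
  assumes comult_type: "\<Delta> x \<in> tensor2 ract lact"
    and comult_add: "\<Delta> (x + y) = tensor2_rel ract lact `` {sweedler \<Delta> x + sweedler \<Delta> y}"
    and comult_bimodule: "\<Delta> (ract (lact a x) b) =
          tensor2_rel ract lact `` {image_mset (\<lambda>(u, v). (lact a u, ract v b)) (sweedler \<Delta> x)}"
    and coassoc: "(comult_fst \<Delta> (sweedler \<Delta> x), comult_snd \<Delta> (sweedler \<Delta> x))
          \<in> tensor3_rel ract lact ract lact"
    and counit_add: "\<epsilon> (x + y) = \<epsilon> x + \<epsilon> y"
    and counit_bimodule: "\<epsilon> (ract (lact a x) b) = a * \<epsilon> x * b"
    and counit_left: "(\<Sum>(u, v)\<in>#sweedler \<Delta> x. lact (\<epsilon> u) v) = x"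
    and counit_right: "(\<Sum>(u, v)\<in>#sweedler \<Delta> x. ract u (\<epsilon> v)) = x"

text \<open>The bimodule structures \<open>a \<triangleright> h \<triangleleft> b = s(a) t(b) h\<close> of a left and
  \<open>a \<triangleright> h \<triangleleft> b = h t(a) s(b)\<close> of a right bialgebroid.\<close>

definition left_lact :: "('a \<Rightarrow> 'h::ring) \<Rightarrow> 'a \<Rightarrow> 'h \<Rightarrow> 'h" where "left_lact s a h = s a * h"
definition left_ract :: "('a \<Rightarrow> 'h::ring) \<Rightarrow> 'h \<Rightarrow> 'a \<Rightarrow> 'h" where "left_ract t h b = t b * h"
definition right_lact :: "('a \<Rightarrow> 'h::ring) \<Rightarrow> 'a \<Rightarrow> 'h \<Rightarrow> 'h" where "right_lact t a h = h * t a"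
definition right_ract :: "('a \<Rightarrow> 'h::ring) \<Rightarrow> 'h \<Rightarrow> 'a \<Rightarrow> 'h" where "right_ract s h b = h * s b"

definition left_takeuchi ::
  "('a \<Rightarrow> 'h::ring) \<Rightarrow> ('a \<Rightarrow> 'h) \<Rightarrow> ('h \<times> 'h) multiset set set" where
  "left_takeuchi s t =
     {X \<in> tensor2 (left_ract t) (left_lact s). \<forall>c\<in>X. \<forall>a.
        (image_mset (\<lambda>(x, y). (x * t a, y)) c, image_mset (\<lambda>(x, y). (x, y * s a)) c)
          \<in> tensor2_rel (left_ract t) (left_lact s)}"

definition right_takeuchi ::
  "('a \<Rightarrow> 'h::ring) \<Rightarrow> ('a \<Rightarrow> 'h) \<Rightarrow> ('h \<times> 'h) multiset set set" where
  "right_takeuchi s t =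
     {X \<in> tensor2 (right_ract s) (right_lact t). \<forall>c\<in>X. \<forall>a.
        (image_mset (\<lambda>(x, y). (s a * x, y)) c, image_mset (\<lambda>(x, y). (x, t a * y)) c)
          \<in> tensor2_rel (right_ract s) (right_lact t)}"

locale left_bialgebroid =
  algebra_morphism scaleA oneA scaleH oneH s + anti: algebra_antimorphism scaleA oneA scaleH oneH t +
  coring scaleA oneA scaleH "left_lact s" "left_ract t" \<Delta> \<epsilon>
  for scaleA :: "'k::field \<Rightarrow> 'a::ring \<Rightarrow> 'a" and oneA
    and scaleH :: "'k \<Rightarrow> 'h::ring \<Rightarrow> 'h" and oneH s t \<Delta> \<epsilon> +
  assumes source_target_commute: "s a * t b = t b * s a"
    and comult_takeuchi: "range \<Delta> \<subseteq> left_takeuchi s t"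
    and comult_one: "\<Delta> oneH = tensor2_rel (left_ract t) (left_lact s) `` {{#(oneH, oneH)#}}"
    and comult_mult: "\<Delta> (h * k) = tensor2_rel (left_ract t) (left_lact s) ``
          {tensor_mult (sweedler \<Delta> h) (sweedler \<Delta> k)}"
    and counit_mult_source: "\<epsilon> (h * k) = \<epsilon> (h * s (\<epsilon> k))"
    and counit_mult_target: "\<epsilon> (h * k) = \<epsilon> (h * t (\<epsilon> k))"

locale right_bialgebroid =
  algebra_morphism scaleA oneA scaleH oneH s + anti: algebra_antimorphism scaleA oneA scaleH oneH t +
  coring scaleA oneA scaleH "right_lact t" "right_ract s" \<Delta> \<epsilon>
  for scaleA :: "'k::field \<Rightarrow> 'a::ring \<Rightarrow> 'a" and oneA
    and scaleH :: "'k \<Rightarrow> 'h::ring \<Rightarrow> 'h" and oneH s t \<Delta> \<epsilon> +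
  assumes source_target_commute: "s a * t b = t b * s a"
    and comult_takeuchi: "range \<Delta> \<subseteq> right_takeuchi s t"
    and comult_one: "\<Delta> oneH = tensor2_rel (right_ract s) (right_lact t) `` {{#(oneH, oneH)#}}"
    and comult_mult: "\<Delta> (h * k) = tensor2_rel (right_ract s) (right_lact t) ``
          {tensor_mult (sweedler \<Delta> h) (sweedler \<Delta> k)}"
    and counit_mult_source: "\<epsilon> (h * k) = \<epsilon> (s (\<epsilon> h) * k)"
    and counit_mult_target: "\<epsilon> (h * k) = \<epsilon> (t (\<epsilon> h) * k)"

section \<open>Hopf algebroids and local biretractions\<close>

text \<open>In \<open>mixed_coassoc1\<close> the equation lives in \<open>H \<otimes>\<^sub>A H \<otimes>\<^sub>A H\<close> with the left bialgebroid structure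
  used for the first and the right one for the second tensor sign; in \<open>mixed_coassoc2\<close> the roles
  are exchanged.\<close>

locale hopf_algebroid =
  L: left_bialgebroid scaleA oneA scaleH oneH s\<^sub>l t\<^sub>l \<Delta>\<^sub>l \<epsilon>\<^sub>l +
  R: right_bialgebroid scaleA oneA scaleH oneH s\<^sub>r t\<^sub>r \<Delta>\<^sub>r \<epsilon>\<^sub>r
  for scaleA :: "'k::field \<Rightarrow> 'a::comm_ring \<Rightarrow> 'a" and oneA
    and scaleH :: "'k \<Rightarrow> 'h::ring \<Rightarrow> 'h" and oneH s\<^sub>l t\<^sub>l \<Delta>\<^sub>l \<epsilon>\<^sub>l s\<^sub>r t\<^sub>r \<Delta>\<^sub>r \<epsilon>\<^sub>r +
  fixes S :: "'h \<Rightarrow> 'h"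
  assumes antipode_linear: "Vector_Spaces.linear scaleH scaleH S"
    and sl_counit_tr: "s\<^sub>l (\<epsilon>\<^sub>l (t\<^sub>r a)) = t\<^sub>r a"
    and tl_counit_sr: "t\<^sub>l (\<epsilon>\<^sub>l (s\<^sub>r a)) = s\<^sub>r a"
    and sr_counit_tl: "s\<^sub>r (\<epsilon>\<^sub>r (t\<^sub>l a)) = t\<^sub>l a"
    and tr_counit_sl: "t\<^sub>r (\<epsilon>\<^sub>r (s\<^sub>l a)) = s\<^sub>l a"
    and mixed_coassoc1:
      "(comult_fst \<Delta>\<^sub>l (sweedler \<Delta>\<^sub>r h), comult_snd \<Delta>\<^sub>r (sweedler \<Delta>\<^sub>l h))
         \<in> tensor3_rel (left_ract t\<^sub>l) (left_lact s\<^sub>l) (right_ract s\<^sub>r) (right_lact t\<^sub>r)"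
    and mixed_coassoc2:
      "(comult_fst \<Delta>\<^sub>r (sweedler \<Delta>\<^sub>l h), comult_snd \<Delta>\<^sub>l (sweedler \<Delta>\<^sub>r h))
         \<in> tensor3_rel (right_ract s\<^sub>r) (right_lact t\<^sub>r) (left_ract t\<^sub>l) (left_lact s\<^sub>l)"
    and antipode_twist: "S (t\<^sub>l a * h * t\<^sub>r b) = s\<^sub>r b * S h * s\<^sub>l a"
    and antipode_left: "(\<Sum>(x, y)\<in>#sweedler \<Delta>\<^sub>l h. S x * y) = s\<^sub>r (\<epsilon>\<^sub>r h)"
    and antipode_right: "(\<Sum>(x, y)\<in>#sweedler \<Delta>\<^sub>r h. x * S y) = s\<^sub>l (\<epsilon>\<^sub>l h)"

definition local_biretractions ::
  "('k::field \<Rightarrow> 'a::comm_ring \<Rightarrow> 'a) \<Rightarrow> ('k \<Rightarrow> 'h::ring \<Rightarrow> 'h) \<Rightarrow> 'h \<Rightarrow>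
   ('a \<Rightarrow> 'h) \<Rightarrow> ('a \<Rightarrow> 'h) \<Rightarrow> ('h \<Rightarrow> 'a) set" where
  "local_biretractions scaleA scaleH oneH s t =
     {\<alpha>. Vector_Spaces.linear scaleH scaleA \<alpha> \<and>
         (\<forall>h k. \<alpha> (h * k) = \<alpha> h * \<alpha> k) \<and>
         (\<forall>a. \<alpha> (s a) = a * \<alpha> oneH) \<and>
         (\<exists>e. \<alpha> (t e) = \<alpha> oneH \<and>
              bij_betw (\<alpha> \<circ> t) {a * e |a. True} {a * \<alpha> oneH |a. True})}"

definition convolution ::
  "('h::ring \<Rightarrow> ('h \<times> 'h) multiset set) \<Rightarrow> ('a \<Rightarrow> 'h) \<Rightarrow>
   ('h \<Rightarrow> 'a) \<Rightarrow> ('h \<Rightarrow> 'a) \<Rightarrow> 'h \<Rightarrow> 'a" where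
  "convolution \<Delta> t \<alpha> \<beta> h = \<beta> (\<Sum>(x, y)\<in>#sweedler \<Delta> h. t (\<alpha> x) * y)"

definition regular_semigroup_on :: "'x set \<Rightarrow> ('x \<Rightarrow> 'x \<Rightarrow> 'x) \<Rightarrow> bool" where
  "regular_semigroup_on X f \<longleftrightarrow>
     (\<forall>x\<in>X. \<forall>y\<in>X. f x y \<in> X) \<and>
     (\<forall>x\<in>X. \<forall>y\<in>X. \<forall>z\<in>X. f (f x y) z = f x (f y z)) \<and>
     (\<forall>x\<in>X. \<exists>y\<in>X. f (f x y) x = x \<and> f (f y x) y = y)"

end

theory Submission
  imports Defs
begin

text \<open>
  Write \<open>p = \<alpha>(1)\<close> for a local biretraction \<open>\<alpha>\<close>.  The condition on \<open>\<alpha> \<circ> t\<close> says that this ring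
  endomorphism of \<open>A\<close> restricts to an isomorphism \<open>Ae \<rightarrow> Ap\<close> of ideals generated by idempotents, so
  \<open>\<alpha>\<close> comes with a partial inverse \<open>\<psi>\<close> of \<open>\<alpha> \<circ> t\<close> (\<open>biretraction_pair\<close>, \<open>local_biretractions_iff\<close>).
  The formulas \<open>\<Delta>\<^sub>l(t a) = t a \<otimes> 1\<close> and \<open>\<Delta>\<^sub>l(s a) = 1 \<otimes> s a\<close> show that
  \<open>(\<alpha> * \<beta>) \<circ> t = \<beta> \<circ> t \<circ> \<alpha> \<circ> t\<close>, hence a convolution of biretractions is one, with partial inverse
  \<open>\<psi> \<circ> \<chi>\<close> if \<open>\<chi>\<close> is that of \<open>\<beta> \<circ> t\<close>; associativity is coassociativity of \<open>\<Delta>\<^sub>l\<close>.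

  For regularity the obvious candidate is \<open>\<rho> = \<psi> \<circ> \<alpha> \<circ> S\<close>.  It is multiplicative because \<open>A\<close> is
  commutative and \<open>S\<close> reverses products (\<open>S_mult\<close>).  However \<open>S(h\<^sub>1) h\<^sub>2 = s(\<epsilon>\<^sub>r h)\<close> gives
  \<open>\<rho> * \<alpha> = p \<epsilon>\<^sub>r\<close>, whereas it is \<open>p \<epsilon>\<^sub>l\<close> that satisfies \<open>\<alpha> * p \<epsilon>\<^sub>l = \<alpha>\<close>, and the two
  counits differ in general: if the antipode of an ordinary Hopf algebra is twisted by a character,
  then \<open>\<epsilon>\<^sub>r\<close> is this character and \<open>\<epsilon>\<^sub>l\<close> is the original counit.  The remedy is to convolve along
  \<open>\<Delta>\<^sub>r\<close>, from the left, with the multiplicative map \<open>\<rho> \<circ> t \<circ> \<epsilon>\<^sub>l\<close>: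
  \<open>\<alpha>'(h) = \<Sum> \<rho>(t(\<epsilon>\<^sub>l(h\<^sup>1))) \<rho>(h\<^sup>2)\<close>.
  Mixed coassociativity then turns \<open>\<alpha>' * \<alpha>\<close> into \<open>\<Sum> p \<epsilon>\<^sub>l(h\<^sup>1) \<epsilon>\<^sub>r(h\<^sup>2) = p \<epsilon>\<^sub>l(h)\<close>, by the counit
  property of \<open>\<epsilon>\<^sub>r\<close> (\<open>pseudo_inverse_convolution\<close>).  Since \<open>p \<epsilon>\<^sub>l\<close> is a right unit for \<open>\<alpha>\<close> and a left
  unit for \<open>\<alpha>'\<close>, the map \<open>\<alpha>'\<close> is a pseudo-inverse of \<open>\<alpha>\<close>.
\<close>

section \<open>Evaluating maps on tensors\<close>

definition balanced_map ::
  "('m::ab_group_add \<Rightarrow> 'a \<Rightarrow> 'm) \<Rightarrow> ('a \<Rightarrow> 'n::ab_group_add \<Rightarrow> 'n) \<Rightarrow>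
   ('m \<Rightarrow> 'n \<Rightarrow> 'b::ab_group_add) \<Rightarrow> bool" where
  "balanced_map ract lact f \<longleftrightarrow>
     (\<forall>y. Modules.additive (\<lambda>x. f x y)) \<and> (\<forall>x. Modules.additive (f x)) \<and>
     (\<forall>x a y. f (ract x a) y = f x (lact a y))"

definition balanced_map3 ::
  "('m::ab_group_add \<Rightarrow> 'a \<Rightarrow> 'm) \<Rightarrow> ('a \<Rightarrow> 'n::ab_group_add \<Rightarrow> 'n) \<Rightarrow>
   ('n \<Rightarrow> 'b \<Rightarrow> 'n) \<Rightarrow> ('b \<Rightarrow> 'p::ab_group_add \<Rightarrow> 'p) \<Rightarrow>
   ('m \<Rightarrow> 'n \<Rightarrow> 'p \<Rightarrow> 'c::ab_group_add) \<Rightarrow> bool" where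
  "balanced_map3 ract lact ract' lact' f \<longleftrightarrow>
     (\<forall>z. balanced_map ract lact (\<lambda>x y. f x y z)) \<and> (\<forall>x. balanced_map ract' lact' (f x))"

definition comult_sum ::
  "('h \<Rightarrow> ('u \<times> 'v) multiset set) \<Rightarrow> ('u \<Rightarrow> 'v \<Rightarrow> 'b::comm_monoid_add) \<Rightarrow> 'h \<Rightarrow> 'b" where
  "comult_sum \<Delta> f h = (\<Sum>(x, y)\<in>#sweedler \<Delta> h. f x y)"

text \<open>
  An invariant of formal sums with values in a commutative monoid descends to the quotient as soon
  as it respects the generating relations; this is the universal property of the tensor products.
\<close>

lemma additive_congruence_sum_mset:
  fixes f :: "'x \<Rightarrow> 'b::comm_monoid_add"
  assumes "additive_congruence G c d"
    and "\<And>c d. G c d \<Longrightarrow> (\<Sum>x\<in>#c. f x) = (\<Sum>x\<in>#d. f x)"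
  shows "(\<Sum>x\<in>#c. f x) = (\<Sum>x\<in>#d. f x)"
  using assms by induction auto

lemma balanced_map_tensor2:
  assumes f: "balanced_map ract lact f" and "(c, d) \<in> tensor2_rel ract lact"
  shows "(\<Sum>(x, y)\<in>#c. f x y) = (\<Sum>(x, y)\<in>#d. f x y)"
proof -
  have add: "f (x + x') y = f x y + f x' y" "f x (y + y') = f x y + f x y'"
    and bal: "f (ract x a) y = f x (lact a y)" for x x' y y' a
    using f by (auto simp: balanced_map_def Modules.additive_def)
  have zero: "f 0 y = 0" "f x 0 = 0" for x y
    using add(1)[of 0 0 y] add(2)[of x 0 0] by simp_all
  have "additive_congruence (tensor2_gen ract lact) c d"
    using assms(2) by (simp add: tensor2_rel_def)
  then show ?thesis
  proof (rule additive_congruence_sum_mset)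
    fix c d assume "tensor2_gen ract lact c d"
    then show "(\<Sum>(x, y)\<in>#c. f x y) = (\<Sum>(x, y)\<in>#d. f x y)"
      by cases (simp_all add: add zero bal)
  qed
qed

lemma balanced_map3_tensor3:
  assumes f: "balanced_map3 ract lact ract' lact' f"
    and "(c, d) \<in> tensor3_rel ract lact ract' lact'"
  shows "(\<Sum>(x, y, z)\<in>#c. f x y z) = (\<Sum>(x, y, z)\<in>#d. f x y z)"
proof -
  have add: "f (x + x') y z = f x y z + f x' y z" "f x (y + y') z = f x y z + f x y' z"
      "f x y (z + z') = f x y z + f x y z'"
    and bal: "f (ract x a) y z = f x (lact a y) z" "f x (ract' y b) z = f x y (lact' b z)"
    for x x' y y' z z' a b
    using f by (auto simp: balanced_map3_def balanced_map_def Modules.additive_def)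
  have zero: "f 0 y z = 0" "f x 0 z = 0" "f x y 0 = 0" for x y z
    using add(1)[of 0 0 y z] add(2)[of x 0 0 z] add(3)[of x y 0 0] by simp_all
  have "additive_congruence (tensor3_gen ract lact ract' lact') c d"
    using assms(2) by (simp add: tensor3_rel_def)
  then show ?thesis
  proof (rule additive_congruence_sum_mset)
    fix c d assume "tensor3_gen ract lact ract' lact' c d"
    then show "(\<Sum>(x, y, z)\<in>#c. f x y z) = (\<Sum>(x, y, z)\<in>#d. f x y z)"
      by cases (simp_all add: add zero bal)
  qed
qed

lemma equiv_tensor2_rel: "equiv UNIV (tensor2_rel ract lact)"
  by (auto simp: tensor2_rel_def equiv_def refl_on_def sym_on_def trans_on_def
      intro: additive_congruence.intros)

lemma additive_comult_sum:
  assumes "Modules.additive g"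
  shows "g (comult_sum \<Delta> f h) = comult_sum \<Delta> (\<lambda>x y. g (f x y)) h"
proof -
  have "g (\<Sum>(x, y)\<in>#c. f x y) = (\<Sum>(x, y)\<in>#c. g (f x y))" for c
    by (induction c) (auto simp: assms Modules.additive.add Modules.additive.zero)
  then show ?thesis by (simp add: comult_sum_def)
qed

lemma comult_sum_add_fun:
  "comult_sum \<Delta> (\<lambda>x y. f x y + g x y) h = comult_sum \<Delta> f h + comult_sum \<Delta> g h"
  by (simp add: comult_sum_def case_prod_unfold sum_mset.distrib)

lemma comult_sum_mult_left:
  fixes c :: "'b::ring"
  shows "c * comult_sum \<Delta> f h = comult_sum \<Delta> (\<lambda>x y. c * f x y) h"
  by (rule additive_comult_sum) (simp add: Modules.additive_def distrib_left)

lemma comult_sum_mult_right: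
  fixes c :: "'b::ring"
  shows "comult_sum \<Delta> f h * c = comult_sum \<Delta> (\<lambda>x y. f x y * c) h"
  by (rule additive_comult_sum[where g = "\<lambda>x. x * c"])
    (simp add: Modules.additive_def distrib_right)

text \<open>
  Summing over the representative picked by \<open>sweedler\<close> is an ordinary finite sum, so double sums over
  two independent comultiplications may be interchanged for arbitrary summands.
\<close>

lemma comult_sum_swap:
  "comult_sum \<Delta> (\<lambda>x y. comult_sum \<Delta>' (f x y) k) h =
   comult_sum \<Delta>' (\<lambda>u v. comult_sum \<Delta> (\<lambda>x y. f x y u v) h) k"
  unfolding comult_sum_def case_prod_unfold by (rule sum_mset.swap)

lemma sum_comult_fst:
  "(\<Sum>(x, y, z)\<in>#comult_fst \<Delta> c. f x y z) = (\<Sum>(x, z)\<in>#c. comult_sum \<Delta> (\<lambda>u v. f u v z) x)"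
  by (induction c)
    (auto simp: comult_fst_def comult_sum_def case_prod_unfold image_mset.compositionality comp_def)

lemma sum_comult_snd:
  "(\<Sum>(x, y, z)\<in>#comult_snd \<Delta> c. f x y z) = (\<Sum>(x, y)\<in>#c. comult_sum \<Delta> (f x) y)"
  by (induction c)
    (auto simp: comult_snd_def comult_sum_def case_prod_unfold image_mset.compositionality comp_def)

lemma sum_tensor_mult:
  "(\<Sum>(x, y)\<in>#tensor_mult c d. f x y) = (\<Sum>(x, y)\<in>#c. \<Sum>(u, v)\<in>#d. f (x * u) (y * v))"
  by (induction c)
    (auto simp: tensor_mult_def case_prod_unfold image_mset.compositionality comp_def)

context coring
begin

lemma sweedler_in: "sweedler \<Delta> x \<in> \<Delta> x"
proof -
  have "\<Delta> x \<noteq> {}"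
    using comult_type[of x] in_quotient_imp_non_empty[OF equiv_tensor2_rel] by (metis tensor2_def)
  then show ?thesis unfolding sweedler_def by (metis all_not_in_conv someI)
qed

lemma comult_sum_eq:
  assumes f: "balanced_map ract lact f" and c: "c \<in> \<Delta> x"
  shows "(\<Sum>(x, y)\<in>#c. f x y) = comult_sum \<Delta> f x"
proof -
  have "(c, sweedler \<Delta> x) \<in> tensor2_rel ract lact"
    using c sweedler_in comult_type[of x] equiv_tensor2_rel
    by (metis quotient_eq_iff tensor2_def)
  then show ?thesis
    unfolding comult_sum_def by (rule balanced_map_tensor2[OF f])
qed

text \<open>
  The coring axioms describe \<open>\<Delta> x\<close> as the class of some formal sum.  For balanced summands this sum
  may replace the representative picked by \<open>sweedler\<close>, which makes all such axioms usable as
  rewrite rules for Sweedler sums.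
\<close>

lemma comult_sum_of_class:
  assumes "balanced_map ract lact f" and "\<Delta> x = tensor2_rel ract lact `` {c}"
  shows "comult_sum \<Delta> f x = (\<Sum>(x, y)\<in>#c. f x y)"
proof -
  have "c \<in> \<Delta> x"
    using assms(2) equiv_class_self[OF equiv_tensor2_rel] by fast
  then show ?thesis using comult_sum_eq[OF assms(1)] by simp
qed

lemma additive_comult_sum_arg:
  assumes "balanced_map ract lact f"
  shows "Modules.additive (comult_sum \<Delta> f)"
proof
  show "comult_sum \<Delta> f (x + y) = comult_sum \<Delta> f x + comult_sum \<Delta> f y" for x y
    using comult_sum_of_class[OF assms comult_add[of x y]] by (simp add: comult_sum_def)
qed

lemma comult_sum_bimodule:
  assumes "balanced_map ract lact f"
  shows "comult_sum \<Delta> f (ract (lact a x) b) = comult_sum \<Delta> (\<lambda>u v. f (lact a u) (ract v b)) x"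
  using comult_sum_of_class[OF assms comult_bimodule[of a x b]]
  by (simp add: comult_sum_def image_mset.compositionality comp_def case_prod_unfold)

lemma comult_sum_coassoc:
  assumes "balanced_map3 ract lact ract lact f"
  shows "comult_sum \<Delta> (\<lambda>x z. comult_sum \<Delta> (\<lambda>u v. f u v z) x) h =
         comult_sum \<Delta> (\<lambda>x y. comult_sum \<Delta> (f x) y) h"
  using balanced_map3_tensor3[OF assms coassoc[of h]]
  by (simp add: sum_comult_fst sum_comult_snd comult_sum_def)

end

section \<open>Hopf algebroids with \<open>s\<^sub>l = t\<^sub>r\<close> and \<open>s\<^sub>r = t\<^sub>l\<close>\<close>

text \<open>
  Here \<open>\<otimes>\<^sub>A\<close> is balanced by \<open>s(a)x \<otimes> y = x \<otimes> t(a)y\<close> on the left and by \<open>x s(a) \<otimes> y = x \<otimes> y t(a)\<close> on the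
  right bialgebroid, and the Takeuchi condition of each side has the form of the balancing relation of the other.
\<close>

locale swapped_hopf_algebroid =
  hopf_algebroid scaleA oneA scaleH oneH t s \<Delta>\<^sub>l \<epsilon>\<^sub>l s t \<Delta>\<^sub>r \<epsilon>\<^sub>r S
  for scaleA :: "'k::field \<Rightarrow> 'a::comm_ring \<Rightarrow> 'a" and oneA
    and scaleH :: "'k \<Rightarrow> 'h::ring \<Rightarrow> 'h" and oneH s t \<Delta>\<^sub>l \<epsilon>\<^sub>l \<Delta>\<^sub>r \<epsilon>\<^sub>r S
begin

abbreviation "balanced_l \<equiv> balanced_map (left_ract s) (left_lact t)"
abbreviation "balanced_r \<equiv> balanced_map (right_ract s) (right_lact t)"
abbreviation "sum_l \<equiv> comult_sum \<Delta>\<^sub>l"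
abbreviation "sum_r \<equiv> comult_sum \<Delta>\<^sub>r"

lemma balanced_lI:
  assumes "\<And>x x' y. f (x + x') y = f x y + f x' y" "\<And>x y y'. f x (y + y') = f x y + f x y'"
    and "\<And>x a y. f (s a * x) y = f x (t a * y)"
  shows "balanced_l f"
  using assms by (auto simp: balanced_map_def Modules.additive_def left_ract_def left_lact_def)

lemma balanced_rI:
  assumes "\<And>x x' y. f (x + x') y = f x y + f x' y" "\<And>x y y'. f x (y + y') = f x y + f x y'"
    and "\<And>x a y. f (x * s a) y = f x (y * t a)"
  shows "balanced_r f"
  using assms by (auto simp: balanced_map_def Modules.additive_def right_ract_def right_lact_def)

lemma S_add: "S (x + y) = S x + S y"
proof -
  interpret S: Vector_Spaces.linear scaleH scaleH S by (rule antipode_linear)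
  show ?thesis by (rule S.add)
qed

lemma oneA: "oneA * a = a" "a * oneA = a"
  by (rule L.A.one_left L.A.one_right)+

lemma oneH: "oneH * h = h" "h * oneH = h"
  by (rule L.B.one_left L.B.one_right)+

lemmas s_add = L.anti.add and t_add = L.add and s_mult = R.map_mult and t_mult = L.map_mult
  and s_one = R.map_one and t_one = L.map_one and st_commute = R.source_target_commute

lemma s_left_commute: "s a * (s b * h) = s b * (s a * h)"
  by (metis mult.assoc mult.commute s_mult)

lemma t_left_commute: "t a * (t b * h) = t b * (t a * h)"
  by (metis mult.assoc mult.commute t_mult)

lemmas additive_simps = S_add s_add t_add L.counit_add R.counit_add distrib_left distrib_right

subsection \<open>Sweedler calculus\<close>

lemma sum_l_t_mult:
  assumes "balanced_l f" shows "sum_l f (t a * h) = sum_l (\<lambda>x y. f (t a * x) y) h"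
  using L.comult_sum_bimodule[OF assms, of a h oneA]
  by (simp add: left_lact_def left_ract_def s_one oneH)

lemma sum_l_s_mult:
  assumes "balanced_l f" shows "sum_l f (s a * h) = sum_l (\<lambda>x y. f x (s a * y)) h"
  using L.comult_sum_bimodule[OF assms, of oneA h a]
  by (simp add: left_lact_def left_ract_def t_one oneH)

lemma sum_r_mult_t:
  assumes "balanced_r f" shows "sum_r f (h * t a) = sum_r (\<lambda>x y. f (x * t a) y) h"
  using R.comult_sum_bimodule[OF assms, of a h oneA]
  by (simp add: right_lact_def right_ract_def s_one oneH)

lemma sum_r_mult_s:
  assumes "balanced_r f" shows "sum_r f (h * s a) = sum_r (\<lambda>x y. f x (y * s a)) h"
  using R.comult_sum_bimodule[OF assms, of oneA h a]
  by (simp add: right_lact_def right_ract_def t_one oneH)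

lemma sum_l_one: assumes "balanced_l f" shows "sum_l f oneH = f oneH oneH"
  using L.comult_sum_of_class[OF assms L.comult_one] by simp

lemma sum_r_one: assumes "balanced_r f" shows "sum_r f oneH = f oneH oneH"
  using R.comult_sum_of_class[OF assms R.comult_one] by simp

lemma balanced_l_mult_t:
  assumes "balanced_l f" shows "balanced_l (\<lambda>x y. f (t a * x) y)"
  using assms
  by (auto simp: balanced_map_def Modules.additive_def left_ract_def left_lact_def distrib_left)
    (metis mult.assoc st_commute)

lemma sum_l_t: assumes "balanced_l f" shows "sum_l f (t a) = f (t a) oneH"
  using sum_l_t_mult[OF assms, of a oneH] sum_l_one[OF balanced_l_mult_t[OF assms]]
  by (simp add: oneH)

lemma balanced_l_mult_s:
  assumes "balanced_l f" shows "balanced_l (\<lambda>x y. f x (s a * y))"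
  using assms
  by (auto simp: balanced_map_def Modules.additive_def left_ract_def left_lact_def distrib_left)
    (metis mult.assoc st_commute)

lemma sum_l_s: assumes "balanced_l f" shows "sum_l f (s a) = f oneH (s a)"
  using sum_l_s_mult[OF assms, of a oneH] sum_l_one[OF balanced_l_mult_s[OF assms]]
  by (simp add: oneH)

lemma balanced_r_mult_t:
  assumes "balanced_r f" shows "balanced_r (\<lambda>x y. f (x * t a) y)"
  using assms
  by (auto simp: balanced_map_def Modules.additive_def right_ract_def right_lact_def distrib_right)
    (metis mult.assoc st_commute)

lemma sum_r_t: assumes "balanced_r f" shows "sum_r f (t a) = f (t a) oneH"
  using sum_r_mult_t[OF assms, of oneH a] sum_r_one[OF balanced_r_mult_t[OF assms]]
  by (simp add: oneH)

lemma balanced_r_mult_s: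
  assumes "balanced_r f" shows "balanced_r (\<lambda>x y. f x (y * s a))"
  using assms
  by (auto simp: balanced_map_def Modules.additive_def right_ract_def right_lact_def distrib_right)
    (metis mult.assoc st_commute)

lemma sum_r_s: assumes "balanced_r f" shows "sum_r f (s a) = f oneH (s a)"
  using sum_r_mult_s[OF assms, of oneH a] sum_r_one[OF balanced_r_mult_s[OF assms]]
  by (simp add: oneH)

lemma sum_l_mult:
  assumes "balanced_l f"
  shows "sum_l f (h * k) = sum_l (\<lambda>x y. sum_l (\<lambda>u v. f (x * u) (y * v)) k) h"
  using L.comult_sum_of_class[OF assms L.comult_mult[of h k]]
  by (simp add: sum_tensor_mult comult_sum_def)

lemma sum_r_mult:
  assumes "balanced_r f"
  shows "sum_r f (h * k) = sum_r (\<lambda>x y. sum_r (\<lambda>u v. f (x * u) (y * v)) k) h"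
  using R.comult_sum_of_class[OF assms R.comult_mult[of h k]]
  by (simp add: sum_tensor_mult comult_sum_def)

lemma sum_l_takeuchi:
  assumes "balanced_l f"
  shows "sum_l (\<lambda>x y. f (x * s a) y) h = sum_l (\<lambda>x y. f x (y * t a)) h"
proof -
  let ?c = "sweedler \<Delta>\<^sub>l h"
  have "(image_mset (\<lambda>(x, y). (x * s a, y)) ?c, image_mset (\<lambda>(x, y). (x, y * t a)) ?c)
      \<in> tensor2_rel (left_ract s) (left_lact t)"
    using L.comult_takeuchi L.sweedler_in[of h] by (auto simp: left_takeuchi_def)
  from balanced_map_tensor2[OF assms this] show ?thesis
    by (simp add: comult_sum_def image_mset.compositionality comp_def case_prod_unfold)
qed

lemma sum_r_takeuchi:
  assumes "balanced_r f"
  shows "sum_r (\<lambda>x y. f (s a * x) y) h = sum_r (\<lambda>x y. f x (t a * y)) h"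
proof -
  let ?c = "sweedler \<Delta>\<^sub>r h"
  have "(image_mset (\<lambda>(x, y). (s a * x, y)) ?c, image_mset (\<lambda>(x, y). (x, t a * y)) ?c)
      \<in> tensor2_rel (right_ract s) (right_lact t)"
    using R.comult_takeuchi R.sweedler_in[of h] by (auto simp: right_takeuchi_def)
  from balanced_map_tensor2[OF assms this] show ?thesis
    by (simp add: comult_sum_def image_mset.compositionality comp_def case_prod_unfold)
qed

lemma sum_l_counit:
  "sum_l (\<lambda>x y. t (\<epsilon>\<^sub>l x) * y) h = h" "sum_l (\<lambda>x y. s (\<epsilon>\<^sub>l y) * x) h = h"
  using L.counit_left[of h] L.counit_right[of h]
  by (simp_all add: comult_sum_def left_lact_def left_ract_def)

lemma sum_r_counit:
  "sum_r (\<lambda>x y. y * t (\<epsilon>\<^sub>r x)) h = h" "sum_r (\<lambda>x y. x * s (\<epsilon>\<^sub>r y)) h = h"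
  using R.counit_left[of h] R.counit_right[of h]
  by (simp_all add: comult_sum_def right_lact_def right_ract_def)

lemma sum_lr_mixed:
  assumes "\<And>z. balanced_l (\<lambda>x y. f x y z)" "\<And>x. balanced_r (f x)"
  shows "sum_r (\<lambda>x z. sum_l (\<lambda>u v. f u v z) x) h = sum_l (\<lambda>x y. sum_r (f x) y) h"
  using balanced_map3_tensor3[OF _ mixed_coassoc1[of h], of f] assms
  by (simp add: balanced_map3_def sum_comult_fst sum_comult_snd comult_sum_def)

lemma sum_rl_mixed:
  assumes "\<And>z. balanced_r (\<lambda>x y. f x y z)" "\<And>x. balanced_l (f x)"
  shows "sum_l (\<lambda>x z. sum_r (\<lambda>u v. f u v z) x) h = sum_r (\<lambda>x y. sum_l (f x) y) h"
  using balanced_map3_tensor3[OF _ mixed_coassoc2[of h], of f] assms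
  by (simp add: balanced_map3_def sum_comult_fst sum_comult_snd comult_sum_def)

lemma counit_l_t: "\<epsilon>\<^sub>l (t a * h) = a * \<epsilon>\<^sub>l h" and counit_l_s: "\<epsilon>\<^sub>l (s a * h) = a * \<epsilon>\<^sub>l h"
  using L.counit_bimodule[of oneA h a] L.counit_bimodule[of a h oneA]
  by (simp_all add: left_lact_def left_ract_def s_one t_one oneH oneA mult.commute)

lemma counit_r_t: "\<epsilon>\<^sub>r (h * t a) = a * \<epsilon>\<^sub>r h" and counit_r_s: "\<epsilon>\<^sub>r (h * s a) = a * \<epsilon>\<^sub>r h"
  using R.counit_bimodule[of oneA h a] R.counit_bimodule[of a h oneA]
  by (simp_all add: right_lact_def right_ract_def s_one t_one oneH oneA mult.commute)

text \<open>
  \<open>\<epsilon>\<^sub>l(1)\<close> and \<open>\<epsilon>\<^sub>r(1)\<close> can differ from the unit of \<open>A\<close> because \<open>s\<close> and \<open>t\<close> can have a kernel, but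
  the counit axioms at \<open>1\<close> show that the difference is invisible in \<open>H\<close>.
\<close>

lemma t_counit_l_one: "t (\<epsilon>\<^sub>l oneH) = oneH"
proof -
  have "balanced_l (\<lambda>x y. t (\<epsilon>\<^sub>l x) * y)"
    by (rule balanced_lI) (simp_all add: additive_simps counit_l_s t_mult mult.assoc t_left_commute)
  from sum_l_one[OF this] show ?thesis by (simp add: sum_l_counit oneH)
qed

lemma s_counit_r_one: "s (\<epsilon>\<^sub>r oneH) = oneH"
proof -
  have "balanced_r (\<lambda>x y. x * s (\<epsilon>\<^sub>r y))"
    by (rule balanced_rI) (simp_all add: additive_simps counit_r_t s_mult mult.assoc[symmetric])
  from sum_r_one[OF this] show ?thesis by (simp add: sum_r_counit oneH)
qed

subsection \<open>The antipode reverses products\<close>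

lemma S_s_mult: "S (s a * h) = S h * t a"
  using antipode_twist[of a h oneA] by (simp add: t_one s_one oneH)

lemma S_mult_t: "S (h * t a) = s a * S h"
  using antipode_twist[of oneA h a] by (simp add: t_one s_one oneH)

lemma sum_l_antipode: "sum_l (\<lambda>x y. S x * y) h = s (\<epsilon>\<^sub>r h)"
  using antipode_left by (simp add: comult_sum_def)

lemma sum_r_antipode: "sum_r (\<lambda>x y. x * S y) h = t (\<epsilon>\<^sub>l h)"
  using antipode_right by (simp add: comult_sum_def)

lemma balanced_l_antipode: "balanced_l (\<lambda>x y. S x * y)"
  by (rule balanced_lI) (simp_all add: additive_simps S_s_mult mult.assoc)

lemma S_one: "S oneH = oneH"
  using sum_l_one[OF balanced_l_antipode] by (simp add: sum_l_antipode s_counit_r_one oneH)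

lemma S_s: "S (s a) = t a" and S_t: "S (t a) = s a"
  using S_s_mult[of a oneH] S_mult_t[of oneH a] by (simp_all add: oneH S_one)

text \<open>
  This generalises \<open>S(h) = S(h\<^sub>1) h\<^sub>2 S(h\<^sub>3)\<close>: insert the left counit, write \<open>t(\<epsilon>\<^sub>l y)\<close> as
  \<open>y\<^sup>1 S(y\<^sup>2)\<close>, and regroup by mixed coassociativity.  The product rules for \<open>S\<close>
  below come from choices of \<open>G\<close> whose inner sum \<open>\<Sum> G(u\<^sub>1) u\<^sub>2\<close> collapses to values of \<open>s \<circ> \<epsilon>\<^sub>r\<close>.
\<close>

lemma antipode_expansion:
  assumes add: "\<And>x y. G (x + y) = G x + G y" and Gs: "\<And>a u. G (s a * u) = G u * t a"
  shows "sum_r (\<lambda>x y. sum_l (\<lambda>u v. G u * v) x * S y) k = G k"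
proof -
  have "G k = G (sum_l (\<lambda>x y. s (\<epsilon>\<^sub>l y) * x) k)" by (simp add: sum_l_counit)
  also have "\<dots> = sum_l (\<lambda>x y. G x * t (\<epsilon>\<^sub>l y)) k"
    by (subst additive_comult_sum[of G]) (simp_all add: Modules.additive_def add Gs)
  also have "\<dots> = sum_l (\<lambda>x y. sum_r (\<lambda>u v. G x * u * S v) y) k"
    by (simp add: sum_r_antipode[symmetric] comult_sum_mult_left mult.assoc)
  also have "\<dots> = sum_r (\<lambda>x z. sum_l (\<lambda>u v. G u * v * S z) x) k"
    by (rule sum_lr_mixed[symmetric])
      (rule balanced_lI balanced_rI; simp add: additive_simps add Gs S_mult_t mult.assoc)+
  also have "\<dots> = sum_r (\<lambda>x y. sum_l (\<lambda>u v. G u * v) x * S y) k"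
    by (simp add: comult_sum_mult_right)
  finally show ?thesis ..
qed

text \<open>
  The Takeuchi condition moves \<open>s(a)\<close> from the first leg to \<open>t(a)\<close> on the second one, after which the
  right counit axiom applies inside \<open>S\<close>.
\<close>

lemma sum_r_counit_antipode:
  "sum_r (\<lambda>x y. s (\<epsilon>\<^sub>r (s a * x)) * S y) k = S (t a * k)"
proof -
  have "balanced_r (\<lambda>x y. s (\<epsilon>\<^sub>r x) * S y)"
    by (rule balanced_rI) (simp_all add: additive_simps counit_r_s s_mult S_mult_t
        mult.assoc s_left_commute)
  from sum_r_takeuchi[OF this]
  have "sum_r (\<lambda>x y. s (\<epsilon>\<^sub>r (s a * x)) * S y) k = sum_r (\<lambda>x y. S (t a * (y * t (\<epsilon>\<^sub>r x)))) k"
    by (simp add: S_mult_t mult.assoc[symmetric])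
  also have "\<dots> = S (t a * sum_r (\<lambda>x y. y * t (\<epsilon>\<^sub>r x)) k)"
    by (rule additive_comult_sum[where g = "\<lambda>h. S (t a * h)", symmetric])
      (simp add: Modules.additive_def additive_simps)
  finally show ?thesis by (simp add: sum_r_counit)
qed

text \<open>
  The antipode axioms prescribe \<open>S(h t(a))\<close> and \<open>S(s(a) h)\<close> only; for the other side of \<open>t\<close> one
  expands \<open>G(u) = S(u) s(a)\<close>.
\<close>

lemma S_t_mult: "S (t a * k) = S k * s a"
proof -
  have "sum_l (\<lambda>u v. S u * s a * v) x = s (\<epsilon>\<^sub>r (s a * x))" for x
    using sum_l_s_mult[OF balanced_l_antipode, of a x] by (simp add: sum_l_antipode mult.assoc)
  then show ?thesis
    using antipode_expansion[of "\<lambda>u. S u * s a" k] sum_r_counit_antipode[of a k]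
    by (simp add: additive_simps S_s_mult mult.assoc st_commute)
qed

text \<open>
  The generalisation to Hopf algebroids of \<open>S(h\<^sub>1 k) h\<^sub>2 = S(k) \<epsilon>(h)\<close>, obtained by expanding the
  left hand side as a function of \<open>k\<close>: its inner sum is \<open>S(h\<^sub>1 x\<^sub>1) h\<^sub>2 x\<^sub>2 = s(\<epsilon>\<^sub>r(h x))\<close>.
\<close>

lemma sum_l_antipode_mult: "sum_l (\<lambda>x y. S (x * k) * y) h = S k * s (\<epsilon>\<^sub>r h)"
proof -
  define G where "G u = sum_l (\<lambda>x y. S (x * u) * y) h" for u
  have "G (u + v) = G u + G v" for u v
    by (simp add: G_def additive_simps comult_sum_add_fun)
  moreover have "G (s a * u) = G u * t a" for a u
  proof -
    have "balanced_l (\<lambda>x y. S (x * u) * y)"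
      by (rule balanced_lI) (simp_all add: additive_simps S_s_mult mult.assoc)
    from sum_l_takeuchi[OF this] show ?thesis
      by (simp add: G_def comult_sum_mult_right mult.assoc)
  qed
  ultimately have G: "G k = sum_r (\<lambda>x y. sum_l (\<lambda>u v. G u * v) x * S y) k"
    using antipode_expansion[of G] by simp
  have "sum_l (\<lambda>u v. G u * v) x = s (\<epsilon>\<^sub>r (h * x))" for x
  proof -
    have "sum_l (\<lambda>u v. G u * v) x = sum_l (\<lambda>u v. sum_l (\<lambda>p q. S (p * u) * (q * v)) h) x"
      by (simp add: G_def comult_sum_mult_right mult.assoc)
    also have "\<dots> = sum_l (\<lambda>p q. S p * q) (h * x)"
      unfolding sum_l_mult[OF balanced_l_antipode] by (rule comult_sum_swap)
    finally show ?thesis by (simp add: sum_l_antipode)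
  qed
  then have "G k = sum_r (\<lambda>x y. s (\<epsilon>\<^sub>r (h * x)) * S y) k"
    using G by simp
  also have "\<dots> = S k * s (\<epsilon>\<^sub>r h)"
    using sum_r_counit_antipode[of "\<epsilon>\<^sub>r h" k]
    by (simp add: R.counit_mult_source[of h] S_t_mult)
  finally show ?thesis by (simp add: G_def)
qed

text \<open>
  In the expansion of \<open>G(u) = S(u k)\<close> the inner sums are \<open>S(k) s(\<epsilon>\<^sub>r u)\<close>, so the factor \<open>S(k)\<close> comes out
  in front and the remaining sum is the expansion of \<open>S(h)\<close> through the right counit.
\<close>

theorem S_mult: "S (h * k) = S k * S h"
proof -
  have "S (h * k) = sum_r (\<lambda>x y. sum_l (\<lambda>u v. S (u * k) * v) x * S y) h"
    using antipode_expansion[of "\<lambda>u. S (u * k)" h] by (simp add: additive_simps S_s_mult mult.assoc)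
  also have "\<dots> = sum_r (\<lambda>x y. S k * S (y * t (\<epsilon>\<^sub>r x))) h"
    by (simp add: sum_l_antipode_mult S_mult_t mult.assoc)
  also have "\<dots> = S k * S (sum_r (\<lambda>x y. y * t (\<epsilon>\<^sub>r x)) h)"
    by (rule additive_comult_sum[where g = "\<lambda>h. S k * S h", symmetric])
      (simp add: Modules.additive_def additive_simps)
  finally show ?thesis by (simp add: sum_r_counit)
qed

section \<open>Local biretractions\<close>

text \<open>
  The partial inverse \<open>\<psi>\<close> of \<open>\<alpha> \<circ> t\<close> is kept as a map on all of \<open>A\<close> with values in the ideal \<open>Ae\<close>, and
  then necessarily \<open>e = \<psi>(1)\<close>.  In this form the bijectivity condition consists of equations, which
  compose well.
\<close>

definition biretraction_pair :: "('h \<Rightarrow> 'a) \<Rightarrow> ('a \<Rightarrow> 'a) \<Rightarrow> bool" where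
  "biretraction_pair \<alpha> \<psi> \<longleftrightarrow>
     (\<forall>h k. \<alpha> (h + k) = \<alpha> h + \<alpha> k) \<and> (\<forall>h k. \<alpha> (h * k) = \<alpha> h * \<alpha> k) \<and>
     (\<forall>a. \<alpha> (s a) = a * \<alpha> oneH) \<and>
     (\<forall>a. \<alpha> (t (\<psi> a)) = a * \<alpha> oneH) \<and> (\<forall>a. \<psi> (\<alpha> (t a)) = a * \<psi> oneA) \<and>
     (\<forall>a. \<psi> a * \<psi> oneA = \<psi> a)"

lemma biretraction_pairD:
  assumes "biretraction_pair \<alpha> \<psi>"
  shows "\<alpha> (h + k) = \<alpha> h + \<alpha> k" "\<alpha> (h * k) = \<alpha> h * \<alpha> k" "\<alpha> (s a) = a * \<alpha> oneH"
    "\<alpha> (t (\<psi> a)) = a * \<alpha> oneH" "\<psi> (\<alpha> (t a)) = a * \<psi> oneA" "\<psi> a * \<psi> oneA = \<psi> a"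
    "\<alpha> h * \<alpha> oneH = \<alpha> h" "\<alpha> oneH * \<alpha> h = \<alpha> h"
proof -
  show mult: "\<alpha> (h * k) = \<alpha> h * \<alpha> k" for h k
    using assms by (simp add: biretraction_pair_def)
  show "\<alpha> h * \<alpha> oneH = \<alpha> h" "\<alpha> oneH * \<alpha> h = \<alpha> h"
    by (simp_all add: mult[symmetric] oneH)
qed (use assms in \<open>simp_all add: biretraction_pair_def\<close>)

text \<open>
  Sums and products of values of \<open>\<psi>\<close> lie in \<open>Ae\<close>, where \<open>\<alpha> \<circ> t\<close> is injective, so it suffices to compare
  images under this ring homomorphism.
\<close>

lemma biretraction_pair_inverse_ring_hom:
  assumes "biretraction_pair \<alpha> \<psi>"
  shows "\<psi> (a + b) = \<psi> a + \<psi> b" "\<psi> (a * b) = \<psi> a * \<psi> b"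
    "\<psi> (a * \<alpha> oneH) = \<psi> a" "\<psi> (\<alpha> oneH) = \<psi> oneA" "\<psi> oneA * \<psi> a = \<psi> a"
proof -
  note D = biretraction_pairD[OF assms]
  have inj: "a * \<psi> oneA = b * \<psi> oneA" if "\<alpha> (t a) = \<alpha> (t b)" for a b
    using that D(5) by metis
  have "\<alpha> (t (\<psi> a + \<psi> b)) = \<alpha> (t (\<psi> (a + b)))"
    by (simp add: t_add D(1,4) distrib_right)
  from inj[OF this] show "\<psi> (a + b) = \<psi> a + \<psi> b" by (simp add: distrib_right D(6))
  have "\<alpha> (t (\<psi> a * \<psi> b)) = \<alpha> (t (\<psi> (a * b)))"
    by (simp add: t_mult D(2,4)) (metis D(7) mult.assoc mult.commute)
  from inj[OF this] show "\<psi> (a * b) = \<psi> a * \<psi> b" by (simp add: mult.assoc D(6))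
  show p: "\<psi> (a * \<alpha> oneH) = \<psi> a" for a
    using D(5)[of "\<psi> a"] by (simp add: D(4,6))
  show "\<psi> (\<alpha> oneH) = \<psi> oneA" using p[of oneA] by (simp add: oneA)
  show "\<psi> oneA * \<psi> a = \<psi> a" using D(6)[of a] by (simp add: mult.commute)
qed

lemma scaleH_eq_mult_s: "scaleH c h = h * s (scaleA c oneA)"
  by (simp add: L.anti.scale s_one oneH flip: L.B.scale_mult_right)

text \<open>
  Scalars act through \<open>s\<close>, so linearity over the field follows from additivity, multiplicativity and
  \<open>\<alpha>(s a) = a \<alpha>(1)\<close>.  The element \<open>e\<close> is idempotent because \<open>e\<close> and \<open>e\<^sup>2\<close> both lie in \<open>Ae\<close> and have the
  same image under \<open>\<alpha> \<circ> t\<close>.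
\<close>

lemma local_biretractions_iff:
  "\<alpha> \<in> local_biretractions scaleA scaleH oneH s t \<longleftrightarrow> (\<exists>\<psi>. biretraction_pair \<alpha> \<psi>)"
proof
  assume "\<alpha> \<in> local_biretractions scaleA scaleH oneH s t"
  then obtain e where lin: "Vector_Spaces.linear scaleH scaleA \<alpha>"
    and mult: "\<And>h k. \<alpha> (h * k) = \<alpha> h * \<alpha> k" and s: "\<And>a. \<alpha> (s a) = a * \<alpha> oneH"
    and e: "\<alpha> (t e) = \<alpha> oneH"
    and bij: "bij_betw (\<alpha> \<circ> t) {a * e |a. True} {a * \<alpha> oneH |a. True}"
    by (auto simp: local_biretractions_def)
  interpret \<alpha>: Vector_Spaces.linear scaleH scaleA \<alpha> by (rule lin)
  let ?X = "{a * e |a. True}"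
  define \<psi> where "\<psi> a = inv_into ?X (\<alpha> \<circ> t) (a * \<alpha> oneH)" for a
  have p: "\<alpha> h * \<alpha> oneH = \<alpha> h" for h by (simp add: mult[symmetric] oneH)
  have inj: "x = y" if "x \<in> ?X" "y \<in> ?X" "\<alpha> (t x) = \<alpha> (t y)" for x y
    using bij that by (auto simp: bij_betw_def inj_on_def)
  have \<psi>: "\<psi> a \<in> ?X" "\<alpha> (t (\<psi> a)) = a * \<alpha> oneH" for a
  proof -
    have "a * \<alpha> oneH \<in> (\<alpha> \<circ> t) ` ?X" using bij by (auto simp: bij_betw_def)
    then show "\<psi> a \<in> ?X" "\<alpha> (t (\<psi> a)) = a * \<alpha> oneH"
      using inv_into_into[of _ "\<alpha> \<circ> t" ?X] f_inv_into_f[of _ "\<alpha> \<circ> t" ?X]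
      unfolding \<psi>_def by (simp_all del: mem_Collect_eq)
  qed
  have "e \<in> ?X" using oneA(1)[of e, symmetric] by blast
  have e_idem: "e * e = e"
    by (rule inj) (use \<open>e \<in> ?X\<close> in \<open>auto simp: t_mult mult e p\<close>)
  have "\<psi> oneA = e"
    by (rule inj) (use \<psi>[of oneA] \<open>e \<in> ?X\<close> in \<open>auto simp: oneA e\<close>)
  moreover have "\<psi> (\<alpha> (t a)) = a * e" for a
    by (rule inj) (use \<psi>[of "\<alpha> (t a)"] in \<open>auto simp: t_mult mult e p\<close>)
  moreover have "\<psi> a * e = \<psi> a" for a
    using \<psi>(1)[of a] e_idem by (auto simp: mult.assoc)
  ultimately show "\<exists>\<psi>. biretraction_pair \<alpha> \<psi>"
    using mult s \<psi>(2) by (auto simp: biretraction_pair_def \<alpha>.add intro!: exI[of _ \<psi>])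
next
  assume "\<exists>\<psi>. biretraction_pair \<alpha> \<psi>"
  then obtain \<psi> where \<alpha>: "biretraction_pair \<alpha> \<psi>" ..
  note D = biretraction_pairD[OF \<alpha>] and \<psi> = biretraction_pair_inverse_ring_hom[OF \<alpha>]
  let ?e = "\<psi> oneA"
  have "\<alpha> (scaleH c h) = scaleA c (\<alpha> h)" for c h
    by (simp add: scaleH_eq_mult_s D(2,3) oneA flip: L.A.scale_mult_left L.A.scale_mult_right)
      (simp add: D(7))
  then have "Vector_Spaces.linear scaleH scaleA \<alpha>"
    by (intro Vector_Spaces.linear.intro module_hom.intro module_hom_axioms.intro)
      (simp_all add: D(1) L.A.vector_space_axioms L.B.vector_space_axioms L.A.module_axioms L.B.module_axioms)
  moreover have e: "\<alpha> (t ?e) = \<alpha> oneH" by (simp add: D(4) oneA)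
  moreover have "bij_betw (\<alpha> \<circ> t) {a * ?e |a. True} {a * \<alpha> oneH |a. True}"
  proof (rule bij_betw_byWitness[where f' = \<psi>])
    show "\<forall>a\<in>{a * ?e |a. True}. \<psi> ((\<alpha> \<circ> t) a) = a"
      by (auto simp: D(5,6) mult.assoc)
    show "\<forall>b\<in>{a * \<alpha> oneH |a. True}. (\<alpha> \<circ> t) (\<psi> b) = b"
      by (auto simp: D(4,7) mult.assoc)
    show "(\<alpha> \<circ> t) ` {a * ?e |a. True} \<subseteq> {a * \<alpha> oneH |a. True}"
      by (auto simp: t_mult D(2) e)
    show "\<psi> ` {a * \<alpha> oneH |a. True} \<subseteq> {a * ?e |a. True}"
      by (auto simp: \<psi>(3)) (metis D(6))
  qed
  ultimately show "\<alpha> \<in> local_biretractions scaleA scaleH oneH s t"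
    using D(2,3) by (auto simp: local_biretractions_def)
qed

subsection \<open>Convolution\<close>

lemma balanced_l_convolution:
  assumes "biretraction_pair \<alpha> \<psi>"
  shows "balanced_l (\<lambda>x y. t (\<alpha> x) * y)"
proof -
  note D = biretraction_pairD[OF assms]
  have "\<alpha> (s a * x) = a * \<alpha> x" for a x
    by (simp add: D(2,3,8) mult.assoc)
  then show ?thesis
    by (intro balanced_lI) (simp_all add: additive_simps D(1) t_mult mult.assoc t_left_commute)
qed

lemma convolution_eq:
  assumes "biretraction_pair \<beta> \<chi>"
  shows "convolution \<Delta>\<^sub>l t \<alpha> \<beta> h = sum_l (\<lambda>x y. \<beta> (t (\<alpha> x)) * \<beta> y) h"
  using biretraction_pairD(1,2)[OF assms] additive_comult_sum[of \<beta> \<Delta>\<^sub>l "\<lambda>x y. t (\<alpha> x) * y" h]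
  by (simp add: convolution_def comult_sum_def Modules.additive_def)

lemma convolution_alt: "convolution \<Delta>\<^sub>l t \<alpha> \<beta> h = \<beta> (sum_l (\<lambda>x y. t (\<alpha> x) * y) h)"
  by (simp add: convolution_def comult_sum_def)

lemma convolution_t:
  assumes "biretraction_pair \<alpha> \<psi>"
  shows "convolution \<Delta>\<^sub>l t \<alpha> \<beta> (t a) = \<beta> (t (\<alpha> (t a)))"
  using sum_l_t[OF balanced_l_convolution[OF assms]] by (simp add: convolution_alt oneH)

lemma convolution_s:
  assumes "biretraction_pair \<alpha> \<psi>" "biretraction_pair \<beta> \<chi>"
  shows "convolution \<Delta>\<^sub>l t \<alpha> \<beta> (s a) = a * \<beta> (t (\<alpha> oneH))"
  using sum_l_s[OF balanced_l_convolution[OF assms(1)]] biretraction_pairD[OF assms(2)]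
  by (simp add: convolution_alt mult.left_commute)

lemma convolution_mult:
  assumes "biretraction_pair \<alpha> \<psi>" "biretraction_pair \<beta> \<chi>"
  shows "convolution \<Delta>\<^sub>l t \<alpha> \<beta> (h * k) = convolution \<Delta>\<^sub>l t \<alpha> \<beta> h * convolution \<Delta>\<^sub>l t \<alpha> \<beta> k"
proof -
  note A = biretraction_pairD[OF assms(1)] and B = biretraction_pairD[OF assms(2)]
  have "convolution \<Delta>\<^sub>l t \<alpha> \<beta> (h * k) =
      \<beta> (sum_l (\<lambda>x y. sum_l (\<lambda>u v. t (\<alpha> (x * u)) * (y * v)) k) h)"
    by (simp add: convolution_alt sum_l_mult[OF balanced_l_convolution[OF assms(1)]])
  also have "\<dots> = sum_l (\<lambda>x y. sum_l (\<lambda>u v. \<beta> (t (\<alpha> x)) * \<beta> y * (\<beta> (t (\<alpha> u)) * \<beta> v)) k) h"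
    by (subst additive_comult_sum[of \<beta>] | simp add: Modules.additive_def B(1,2) A(2) t_mult
        mult_ac)+
  also have "\<dots> = convolution \<Delta>\<^sub>l t \<alpha> \<beta> h * convolution \<Delta>\<^sub>l t \<alpha> \<beta> k"
    unfolding convolution_eq[OF assms(2)] comult_sum_mult_right
    unfolding comult_sum_mult_left ..
  finally show ?thesis .
qed

lemma convolution_biretraction_pair:
  assumes "biretraction_pair \<alpha> \<psi>" "biretraction_pair \<beta> \<chi>"
  shows "biretraction_pair (convolution \<Delta>\<^sub>l t \<alpha> \<beta>) (\<psi> \<circ> \<chi>)"
proof -
  note A = biretraction_pairD[OF assms(1)] biretraction_pair_inverse_ring_hom[OF assms(1)]
    and B = biretraction_pairD[OF assms(2)] biretraction_pair_inverse_ring_hom[OF assms(2)]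
  have one: "convolution \<Delta>\<^sub>l t \<alpha> \<beta> oneH = \<beta> (t (\<alpha> oneH))"
    using convolution_t[OF assms(1), of \<beta> oneA] by (simp add: t_one)
  show ?thesis
    unfolding biretraction_pair_def one
  proof (intro conjI allI)
    show "convolution \<Delta>\<^sub>l t \<alpha> \<beta> (h + k) = convolution \<Delta>\<^sub>l t \<alpha> \<beta> h + convolution \<Delta>\<^sub>l t \<alpha> \<beta> k" for h k
      using L.additive_comult_sum_arg[OF balanced_l_convolution[OF assms(1)]]
      by (simp add: convolution_alt Modules.additive_def B(1))
    show "convolution \<Delta>\<^sub>l t \<alpha> \<beta> (t ((\<psi> \<circ> \<chi>) a)) = a * \<beta> (t (\<alpha> oneH))" for a
      by (simp add: convolution_t[OF assms(1)] A(4) B(2,4,8) t_mult mult.assoc)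
    have "\<psi> (\<chi> oneA) = \<psi> (\<chi> oneA) * \<psi> oneA" by (simp add: A(6))
    show "(\<psi> \<circ> \<chi>) (convolution \<Delta>\<^sub>l t \<alpha> \<beta> (t a)) = a * (\<psi> \<circ> \<chi>) oneA" for a
      by (simp add: convolution_t[OF assms(1)] A(5,10,13) B(5) mult.assoc)
    show "(\<psi> \<circ> \<chi>) a * (\<psi> \<circ> \<chi>) oneA = (\<psi> \<circ> \<chi>) a" for a
      by (simp add: A(10)[symmetric] B(6))
  qed (simp_all add: convolution_mult[OF assms] convolution_s[OF assms])
qed

text \<open>
  Both sides evaluate the map \<open>x \<otimes> y \<otimes> z \<mapsto> \<gamma>(t(\<beta>(t(\<alpha> x) y)) z)\<close>, balanced in both places, on the
  two iterated comultiplications of \<open>h\<close>.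
\<close>

lemma convolution_assoc:
  assumes "biretraction_pair \<alpha> \<psi>" "biretraction_pair \<beta> \<chi>" "biretraction_pair \<gamma> \<xi>"
  shows "convolution \<Delta>\<^sub>l t (convolution \<Delta>\<^sub>l t \<alpha> \<beta>) \<gamma> = convolution \<Delta>\<^sub>l t \<alpha> (convolution \<Delta>\<^sub>l t \<beta> \<gamma>)"
proof
  fix h
  note B = biretraction_pairD[OF assms(2)]
  note bal_\<alpha> = balanced_l_convolution[OF assms(1)] and bal_\<beta> = balanced_l_convolution[OF assms(2)]
  let ?f = "\<lambda>x y z. t (\<beta> (t (\<alpha> x) * y)) * z"
  have "convolution \<Delta>\<^sub>l t (convolution \<Delta>\<^sub>l t \<alpha> \<beta>) \<gamma> h =
      \<gamma> (sum_l (\<lambda>x z. sum_l (\<lambda>u v. ?f u v z) x) h)"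
  proof -
    have "t (\<beta> (sum_l f x)) * z = sum_l (\<lambda>u v. t (\<beta> (f u v)) * z) x" for f x z
      by (rule additive_comult_sum[where g = "\<lambda>x. t (\<beta> x) * z"])
        (simp add: Modules.additive_def additive_simps B(1))
    then show ?thesis by (simp add: convolution_alt)
  qed
  also have "\<dots> = \<gamma> (sum_l (\<lambda>x y. sum_l (?f x) y) h)"
  proof (subst L.comult_sum_coassoc)
    show "balanced_map3 (left_ract s) (left_lact t) (left_ract s) (left_lact t) ?f"
      unfolding balanced_map3_def
    proof (intro conjI allI)
      show "balanced_l (\<lambda>x y. ?f x y z)" for z
        using bal_\<alpha> by (auto simp: balanced_map_def Modules.additive_def B(1) additive_simps
            left_ract_def left_lact_def)
      show "balanced_l (?f x)" for x
        using bal_\<beta> by (auto simp: balanced_map_def Modules.additive_def B(1) additive_simps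
            left_ract_def left_lact_def) (metis mult.assoc st_commute)
    qed
  qed simp
  also have "\<dots> = \<gamma> (sum_l (\<lambda>x y. sum_l (\<lambda>u v. t (\<beta> u) * v) (t (\<alpha> x) * y)) h)"
    by (simp add: sum_l_t_mult[OF bal_\<beta>])
  also have "\<dots> = convolution \<Delta>\<^sub>l t \<alpha> (convolution \<Delta>\<^sub>l t \<beta> \<gamma>) h"
    unfolding convolution_alt
    by (subst additive_comult_sum[OF L.additive_comult_sum_arg[OF bal_\<beta>]]) simp
  finally show "convolution \<Delta>\<^sub>l t (convolution \<Delta>\<^sub>l t \<alpha> \<beta>) \<gamma> h =
    convolution \<Delta>\<^sub>l t \<alpha> (convolution \<Delta>\<^sub>l t \<beta> \<gamma>) h" .
qed

subsection \<open>Pseudo-inverses\<close>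

definition antipode_twisted :: "('h \<Rightarrow> 'a) \<Rightarrow> ('a \<Rightarrow> 'a) \<Rightarrow> 'h \<Rightarrow> 'a" where
  "antipode_twisted \<alpha> \<psi> h = \<psi> (\<alpha> (S h))"

text \<open>
  The convolution along \<open>\<Delta>\<^sub>r\<close> of \<open>\<psi> \<circ> \<epsilon>\<^sub>l = \<rho> \<circ> t \<circ> \<epsilon>\<^sub>l\<close> with \<open>\<rho> = \<psi> \<circ> \<alpha> \<circ> S\<close>; the first factor corrects for
  the difference between the two counits.
\<close>

definition pseudo_inverse :: "('h \<Rightarrow> 'a) \<Rightarrow> ('a \<Rightarrow> 'a) \<Rightarrow> 'h \<Rightarrow> 'a" where
  "pseudo_inverse \<alpha> \<psi> h =
     sum_r (\<lambda>x y. antipode_twisted \<alpha> \<psi> (t (\<epsilon>\<^sub>l x)) * antipode_twisted \<alpha> \<psi> y) h"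

lemma antipode_twistedD:
  assumes "biretraction_pair \<alpha> \<psi>"
  defines "\<rho> \<equiv> antipode_twisted \<alpha> \<psi>"
  shows "\<rho> (h + k) = \<rho> h + \<rho> k" "\<rho> (h * k) = \<rho> h * \<rho> k"
    "\<rho> (s a) = a * \<psi> oneA" "\<rho> (t a) = \<psi> a" "\<rho> oneH = \<psi> oneA"
    "\<rho> h * \<psi> oneA = \<rho> h" "\<psi> oneA * \<rho> h = \<rho> h" "\<alpha> (t (\<rho> h)) = \<alpha> (S h)"
  using biretraction_pairD[OF assms(1)] biretraction_pair_inverse_ring_hom[OF assms(1)]
  by (simp_all add: \<rho>_def antipode_twisted_def S_add S_mult S_s S_t S_one)
    (rule mult.commute)

text \<open>
  Counits of bialgebroids are not multiplicative in general, but \<open>\<psi> \<circ> \<epsilon>\<^sub>l\<close> is: applying the multiplicative map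
  \<open>\<rho>\<close> to \<open>t(\<epsilon>\<^sub>l h) = h\<^sup>1 S(h\<^sup>2)\<close> lands in a commutative ring, where the order reversal by \<open>S\<close> is harmless.
\<close>

lemma counit_l_multiplicative:
  assumes "biretraction_pair \<alpha> \<psi>"
  shows "\<psi> (\<epsilon>\<^sub>l (h * k)) = \<psi> (\<epsilon>\<^sub>l h) * \<psi> (\<epsilon>\<^sub>l k)"
proof -
  let ?\<rho> = "antipode_twisted \<alpha> \<psi>"
  note R = antipode_twistedD[OF assms]
  have eq: "\<psi> (\<epsilon>\<^sub>l h) = sum_r (\<lambda>x y. ?\<rho> x * ?\<rho> (S y)) h" for h
  proof -
    have "\<psi> (\<epsilon>\<^sub>l h) = ?\<rho> (sum_r (\<lambda>x y. x * S y) h)"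
      by (simp add: R(4) sum_r_antipode)
    also have "\<dots> = sum_r (\<lambda>x y. ?\<rho> (x * S y)) h"
      by (rule additive_comult_sum) (simp add: Modules.additive_def R(1))
    finally show ?thesis by (simp add: R(2))
  qed
  have bal: "balanced_r (\<lambda>x y. ?\<rho> x * ?\<rho> (S y))"
    by (rule balanced_rI) (simp_all add: additive_simps R(1,2) S_mult_t mult_ac)
  show ?thesis
    unfolding eq sum_r_mult[OF bal] comult_sum_mult_right
    unfolding comult_sum_mult_left by (simp add: R(2) S_mult mult_ac)
qed

lemma counit_l_s_absorb:
  assumes "biretraction_pair \<alpha> \<psi>"
  shows "\<psi> (a * \<epsilon>\<^sub>l oneH) = \<psi> a"
proof -
  have "t (a * \<epsilon>\<^sub>l oneH) = t a" by (simp add: t_mult t_counit_l_one oneH)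
  then show ?thesis using antipode_twistedD(4)[OF assms] by metis
qed

lemma counit_l_mult_s:
  assumes "biretraction_pair \<alpha> \<psi>"
  shows "\<psi> (\<epsilon>\<^sub>l (h * s a)) = \<psi> (\<epsilon>\<^sub>l h) * \<psi> a"
proof -
  have "\<epsilon>\<^sub>l (s a) = a * \<epsilon>\<^sub>l oneH" using counit_l_s[of a oneH] by (simp add: oneH)
  then show ?thesis
    by (simp add: counit_l_multiplicative[OF assms] counit_l_s_absorb[OF assms])
qed

lemma balanced_r_pseudo_inverse:
  assumes "biretraction_pair \<alpha> \<psi>"
  shows "balanced_r (\<lambda>x y. antipode_twisted \<alpha> \<psi> (t (\<epsilon>\<^sub>l x)) * antipode_twisted \<alpha> \<psi> y)"
  by (rule balanced_rI)
    (simp_all add: antipode_twistedD(1,2,4)[OF assms] biretraction_pair_inverse_ring_hom(1)[OF assms]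
      additive_simps counit_l_mult_s[OF assms] mult_ac)

lemma pseudo_inverse_t:
  assumes "biretraction_pair \<alpha> \<psi>"
  shows "pseudo_inverse \<alpha> \<psi> (t a) = \<psi> a"
proof -
  have "\<epsilon>\<^sub>l (t a) = a * \<epsilon>\<^sub>l oneH" using counit_l_t[of a oneH] by (simp add: oneH)
  moreover have "pseudo_inverse \<alpha> \<psi> (t a) =
      antipode_twisted \<alpha> \<psi> (t (\<epsilon>\<^sub>l (t a))) * antipode_twisted \<alpha> \<psi> oneH"
    unfolding pseudo_inverse_def by (rule sum_r_t[OF balanced_r_pseudo_inverse[OF assms]])
  ultimately show ?thesis
    by (simp add: antipode_twistedD(4,5)[OF assms] counit_l_s_absorb[OF assms] biretraction_pairD(6)[OF assms])
qed

lemma pseudo_inverse_one: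
  assumes "biretraction_pair \<alpha> \<psi>"
  shows "pseudo_inverse \<alpha> \<psi> oneH = \<psi> oneA"
  using pseudo_inverse_t[OF assms, of oneA] by (simp add: t_one)

lemma pseudo_inverse_s:
  assumes "biretraction_pair \<alpha> \<psi>"
  shows "pseudo_inverse \<alpha> \<psi> (s a) = a * \<psi> oneA"
proof -
  have "\<psi> (\<epsilon>\<^sub>l oneH) = \<psi> oneA"
    using counit_l_s_absorb[OF assms, of oneA] by (simp add: oneA)
  moreover have "pseudo_inverse \<alpha> \<psi> (s a) =
      antipode_twisted \<alpha> \<psi> (t (\<epsilon>\<^sub>l oneH)) * antipode_twisted \<alpha> \<psi> (s a)"
    unfolding pseudo_inverse_def by (rule sum_r_s[OF balanced_r_pseudo_inverse[OF assms]])
  ultimately show ?thesis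
    by (simp add: antipode_twistedD(3,4)[OF assms] biretraction_pairD(6)[OF assms] mult.left_commute)
qed

lemma pseudo_inverse_mult:
  assumes "biretraction_pair \<alpha> \<psi>"
  shows "pseudo_inverse \<alpha> \<psi> (h * k) = pseudo_inverse \<alpha> \<psi> h * pseudo_inverse \<alpha> \<psi> k"
  unfolding pseudo_inverse_def sum_r_mult[OF balanced_r_pseudo_inverse[OF assms]]
    comult_sum_mult_right
  unfolding comult_sum_mult_left
  by (simp add: antipode_twistedD[OF assms] counit_l_multiplicative[OF assms] mult_ac)

lemma pseudo_inverse_biretraction_pair:
  assumes "biretraction_pair \<alpha> \<psi>"
  shows "biretraction_pair (pseudo_inverse \<alpha> \<psi>) (\<lambda>a. \<alpha> (t a))"
proof -
  note D = biretraction_pairD[OF assms]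
  have "Modules.additive (pseudo_inverse \<alpha> \<psi>)"
    using R.additive_comult_sum_arg[OF balanced_r_pseudo_inverse[OF assms]]
    by (simp add: pseudo_inverse_def Modules.additive_def)
  then show ?thesis
    by (simp add: biretraction_pair_def Modules.additive_def pseudo_inverse_mult[OF assms]
        pseudo_inverse_s[OF assms] pseudo_inverse_t[OF assms] pseudo_inverse_one[OF assms]
        D t_one)
qed

text \<open>
  Mixed coassociativity moves the inner comultiplication onto \<open>S(h\<^sup>2\<^sub>1) h\<^sup>2\<^sub>2 = s(\<epsilon>\<^sub>r(h\<^sup>2))\<close>, and
  multiplicativity of \<open>\<psi> \<circ> \<epsilon>\<^sub>l\<close> absorbs this factor into \<open>\<epsilon>\<^sub>l(h\<^sup>1 s(\<epsilon>\<^sub>r h\<^sup>2))\<close>, where the right counit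
  axiom applies.  Writing \<open>p \<epsilon>\<^sub>l = \<alpha> \<circ> t \<circ> \<psi> \<circ> \<epsilon>\<^sub>l\<close> throughout makes that multiplicativity available.
\<close>

lemma pseudo_inverse_convolution:
  assumes "biretraction_pair \<alpha> \<psi>"
  shows "convolution \<Delta>\<^sub>l t (pseudo_inverse \<alpha> \<psi>) \<alpha> h = \<alpha> oneH * \<epsilon>\<^sub>l h"
proof -
  note D = biretraction_pairD[OF assms] and R = antipode_twistedD[OF assms]
  let ?p = "\<alpha> oneH"
  let ?f = "\<lambda>x y z. \<alpha> (t (\<psi> (\<epsilon>\<^sub>l x))) * \<alpha> (S y) * \<alpha> z"
  have t_pinv: "\<alpha> (t (pseudo_inverse \<alpha> \<psi> x)) =
      sum_r (\<lambda>u v. \<alpha> (t (\<psi> (\<epsilon>\<^sub>l u))) * \<alpha> (S v)) x" for x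
    unfolding pseudo_inverse_def
    by (subst additive_comult_sum[of "\<lambda>x. \<alpha> (t x)"])
      (simp_all add: Modules.additive_def t_add t_mult D(1,2) R(4,8))
  have inner: "sum_l (?f x) y = \<alpha> (t (\<psi> (\<epsilon>\<^sub>l (x * s (\<epsilon>\<^sub>r y)))))" for x y
  proof -
    have "sum_l (?f x) y = \<alpha> (t (\<psi> (\<epsilon>\<^sub>l x))) * \<alpha> (sum_l (\<lambda>u v. S u * v) y)"
      by (subst additive_comult_sum[of \<alpha>])
        (simp_all add: Modules.additive_def D(1,2) comult_sum_mult_left mult.assoc)
    also have "\<dots> = \<alpha> (t (\<psi> (\<epsilon>\<^sub>l x))) * \<alpha> (t (\<psi> (\<epsilon>\<^sub>r y)))"
      by (simp add: sum_l_antipode D(3,4))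
    finally show ?thesis by (simp add: counit_l_mult_s[OF assms] t_mult D(2))
  qed
  have "convolution \<Delta>\<^sub>l t (pseudo_inverse \<alpha> \<psi>) \<alpha> h =
      sum_l (\<lambda>x z. sum_r (\<lambda>u v. ?f u v z) x) h"
    by (simp add: convolution_eq[OF assms] t_pinv comult_sum_mult_right)
  also have "\<dots> = sum_r (\<lambda>x y. sum_l (?f x) y) h"
  proof (rule sum_rl_mixed)
    show "balanced_r (\<lambda>x y. ?f x y z)" for z
      by (rule balanced_rI) (simp_all add: additive_simps D(1,2) S_mult_t t_mult
          counit_l_mult_s[OF assms] biretraction_pair_inverse_ring_hom[OF assms] D(3,4) mult_ac)
    show "balanced_l (?f x)" for x
      by (rule balanced_lI) (simp_all add: additive_simps D(1,2) S_s_mult mult_ac)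
  qed
  also have "\<dots> = sum_r (\<lambda>x y. \<alpha> (t (\<psi> (\<epsilon>\<^sub>l (x * s (\<epsilon>\<^sub>r y)))))) h"
    by (simp add: inner)
  also have "\<dots> = ?p * \<epsilon>\<^sub>l h"
  proof -
    have "sum_r (\<lambda>x y. \<epsilon>\<^sub>l (x * s (\<epsilon>\<^sub>r y)) * ?p) h = \<epsilon>\<^sub>l (sum_r (\<lambda>x y. x * s (\<epsilon>\<^sub>r y)) h) * ?p"
      by (rule additive_comult_sum[where g = "\<lambda>h. \<epsilon>\<^sub>l h * ?p", symmetric])
        (simp add: Modules.additive_def additive_simps)
    then show ?thesis by (simp add: D(4) sum_r_counit mult.commute)
  qed
  finally show ?thesis .
qed

lemma convolution_counit_right:
  assumes "biretraction_pair \<alpha> \<psi>" and u: "\<And>h. u h = \<alpha> oneH * \<epsilon>\<^sub>l h"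
  shows "convolution \<Delta>\<^sub>l t \<alpha> u = \<alpha>"
proof
  fix h
  note D = biretraction_pairD[OF assms(1)]
  have "convolution \<Delta>\<^sub>l t \<alpha> u h = sum_l (\<lambda>x y. u (t (\<alpha> x) * y)) h"
    unfolding convolution_alt
    by (rule additive_comult_sum) (simp add: Modules.additive_def u additive_simps)
  also have "\<dots> = sum_l (\<lambda>x y. \<alpha> (s (\<epsilon>\<^sub>l y) * x)) h"
    by (simp add: u counit_l_t D(2,3) mult_ac)
  also have "\<dots> = \<alpha> (sum_l (\<lambda>x y. s (\<epsilon>\<^sub>l y) * x) h)"
    by (rule additive_comult_sum[symmetric]) (simp add: Modules.additive_def D(1))
  finally show "convolution \<Delta>\<^sub>l t \<alpha> u h = \<alpha> h" by (simp add: sum_l_counit)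
qed

lemma convolution_counit_left:
  assumes "biretraction_pair \<beta> \<chi>" and "\<And>h. u h = p * \<epsilon>\<^sub>l h" and "\<beta> (t p) = \<beta> oneH"
  shows "convolution \<Delta>\<^sub>l t u \<beta> = \<beta>"
proof
  fix h
  note D = biretraction_pairD[OF assms(1)]
  have "convolution \<Delta>\<^sub>l t u \<beta> h = \<beta> (t p * sum_l (\<lambda>x y. t (\<epsilon>\<^sub>l x) * y) h)"
    by (simp add: convolution_alt assms(2) t_mult comult_sum_mult_left mult.assoc)
  then show "convolution \<Delta>\<^sub>l t u \<beta> h = \<beta> h"
    by (simp add: sum_l_counit D(2,8) assms(3))
qed

theorem regular_semigroup_biretractions:
  "regular_semigroup_on (local_biretractions scaleA scaleH oneH s t) (convolution \<Delta>\<^sub>l t)"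
  unfolding regular_semigroup_on_def local_biretractions_iff Ball_def Bex_def
proof (intro conjI allI impI)
  fix \<alpha> \<beta> assume "\<exists>\<psi>. biretraction_pair \<alpha> \<psi>" "\<exists>\<psi>. biretraction_pair \<beta> \<psi>"
  then show "\<exists>\<psi>. biretraction_pair (convolution \<Delta>\<^sub>l t \<alpha> \<beta>) \<psi>"
    using convolution_biretraction_pair by blast
next
  fix \<alpha> \<beta> \<gamma>
  assume "\<exists>\<psi>. biretraction_pair \<alpha> \<psi>" "\<exists>\<psi>. biretraction_pair \<beta> \<psi>" "\<exists>\<psi>. biretraction_pair \<gamma> \<psi>"
  then show "convolution \<Delta>\<^sub>l t (convolution \<Delta>\<^sub>l t \<alpha> \<beta>) \<gamma> = convolution \<Delta>\<^sub>l t \<alpha> (convolution \<Delta>\<^sub>l t \<beta> \<gamma>)"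
    using convolution_assoc by blast
next
  fix \<alpha> assume "\<exists>\<psi>. biretraction_pair \<alpha> \<psi>"
  then obtain \<psi> where \<alpha>: "biretraction_pair \<alpha> \<psi>" ..
  let ?\<beta> = "pseudo_inverse \<alpha> \<psi>"
  have \<beta>: "biretraction_pair ?\<beta> (\<lambda>a. \<alpha> (t a))" by (rule pseudo_inverse_biretraction_pair[OF \<alpha>])
  have u: "convolution \<Delta>\<^sub>l t ?\<beta> \<alpha> h = \<alpha> oneH * \<epsilon>\<^sub>l h" for h
    by (rule pseudo_inverse_convolution[OF \<alpha>])
  have "convolution \<Delta>\<^sub>l t (convolution \<Delta>\<^sub>l t \<alpha> ?\<beta>) \<alpha> = \<alpha>"
    using convolution_assoc[OF \<alpha> \<beta> \<alpha>] convolution_counit_right[OF \<alpha> u] by simp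
  moreover have "convolution \<Delta>\<^sub>l t (convolution \<Delta>\<^sub>l t ?\<beta> \<alpha>) ?\<beta> = ?\<beta>"
    by (rule convolution_counit_left[OF \<beta> u])
      (simp add: pseudo_inverse_t[OF \<alpha>] pseudo_inverse_one[OF \<alpha>]
        biretraction_pair_inverse_ring_hom[OF \<alpha>])
  ultimately show "\<exists>\<beta>. (\<exists>\<psi>. biretraction_pair \<beta> \<psi>) \<and>
      convolution \<Delta>\<^sub>l t (convolution \<Delta>\<^sub>l t \<alpha> \<beta>) \<alpha> = \<alpha> \<and>
      convolution \<Delta>\<^sub>l t (convolution \<Delta>\<^sub>l t \<beta> \<alpha>) \<beta> = \<beta>"
    using \<beta> by blast
qed

lemma convolution_representative:
  assumes "biretraction_pair \<alpha> \<psi>" "biretraction_pair \<beta> \<chi>" "c \<in> \<Delta>\<^sub>l h"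
  shows "convolution \<Delta>\<^sub>l t \<alpha> \<beta> h = \<beta> (\<Sum>(x, y)\<in>#c. t (\<alpha> x) * y)"
    and "convolution \<Delta>\<^sub>l t \<alpha> \<beta> h = (\<Sum>(x, y)\<in>#c. \<beta> (t (\<alpha> x)) * \<beta> y)"
proof -
  note bal = balanced_l_convolution[OF assms(1)] and B = biretraction_pairD[OF assms(2)]
  show "convolution \<Delta>\<^sub>l t \<alpha> \<beta> h = \<beta> (\<Sum>(x, y)\<in>#c. t (\<alpha> x) * y)"
    using L.comult_sum_eq[OF bal assms(3)] by (simp add: convolution_alt)
  have "balanced_l (\<lambda>x y. \<beta> (t (\<alpha> x)) * \<beta> y)"
    using bal by (auto simp: balanced_map_def Modules.additive_def B(1) simp flip: B(2))
  from L.comult_sum_eq[OF this assms(3)]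
  show "convolution \<Delta>\<^sub>l t \<alpha> \<beta> h = (\<Sum>(x, y)\<in>#c. \<beta> (t (\<alpha> x)) * \<beta> y)"
    by (simp add: convolution_eq[OF assms(2)])
qed

end

theorem theorem4p23:
  fixes scaleA :: "'k::field_char_0 \<Rightarrow> 'a::comm_ring \<Rightarrow> 'a" and oneA :: 'a
    and scaleH :: "'k \<Rightarrow> 'h::ring \<Rightarrow> 'h" and oneH :: 'h
    and s\<^sub>l t\<^sub>l s\<^sub>r t\<^sub>r s t :: "'a \<Rightarrow> 'h"
    and \<Delta>\<^sub>l \<Delta>\<^sub>r :: "'h \<Rightarrow> ('h \<times> 'h) multiset set"
    and \<epsilon>\<^sub>l \<epsilon>\<^sub>r :: "'h \<Rightarrow> 'a"
    and S :: "'h \<Rightarrow> 'h"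
  assumes "hopf_algebroid scaleA oneA scaleH oneH s\<^sub>l t\<^sub>l \<Delta>\<^sub>l \<epsilon>\<^sub>l s\<^sub>r t\<^sub>r \<Delta>\<^sub>r \<epsilon>\<^sub>r S"
    and "s\<^sub>l = t" and "t\<^sub>r = t" and "s\<^sub>r = s" and "t\<^sub>l = s"
  defines "Brt \<equiv> local_biretractions scaleA scaleH oneH s t"
    and "conv \<equiv> convolution \<Delta>\<^sub>l t"
  shows "(\<forall>\<alpha>\<in>Brt. \<forall>\<beta>\<in>Brt. \<forall>h. \<forall>c\<in>\<Delta>\<^sub>l h.
            conv \<alpha> \<beta> h = \<beta> (\<Sum>(x, y)\<in>#c. t (\<alpha> x) * y) \<and>
            conv \<alpha> \<beta> h = (\<Sum>(x, y)\<in>#c. \<beta> (t (\<alpha> x)) * \<beta> y))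
         \<and> regular_semigroup_on Brt conv"
proof -
  interpret swapped_hopf_algebroid scaleA oneA scaleH oneH s t \<Delta>\<^sub>l \<epsilon>\<^sub>l \<Delta>\<^sub>r \<epsilon>\<^sub>r S
    using assms(1-5) by (simp add: swapped_hopf_algebroid_def)
  show ?thesis
    unfolding Brt_def conv_def
  proof (intro conjI ballI allI)
    fix \<alpha> \<beta> h c
    assume "\<alpha> \<in> local_biretractions scaleA scaleH oneH s t"
      and "\<beta> \<in> local_biretractions scaleA scaleH oneH s t" and c: "c \<in> \<Delta>\<^sub>l h"
    then obtain \<psi> \<chi> where \<alpha>: "biretraction_pair \<alpha> \<psi>" and \<beta>: "biretraction_pair \<beta> \<chi>"
      unfolding local_biretractions_iff by blast
    show "convolution \<Delta>\<^sub>l t \<alpha> \<beta> h = \<beta> (\<Sum>(x, y)\<in>#c. t (\<alpha> x) * y)"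
      and "convolution \<Delta>\<^sub>l t \<alpha> \<beta> h = (\<Sum>(x, y)\<in>#c. \<beta> (t (\<alpha> x)) * \<beta> y)"
      by (rule convolution_representative[OF \<alpha> \<beta> c])+
  qed (rule regular_semigroup_biretractions)
qed

end
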